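(* Let $0<s_{\min}<s_{\max}$, $L>0$, $\tau>2$, and assume $m\le n^{1/(1+2s_{\max})}$ (where $m=m_n$ may depend on $n$). Let $\hat f_n$ be the two-round distributed estimator $$\hat f_n=\sum_{0\le i\le\hat\ell}\ \sum_{j=0}^{2^i-1}\Big(\frac1m\sum_{k=1}^m y_{ij}^{(k)}\Big)\psi_{ij},$$ where $\hat\ell$ is the data-driven truncation level defined in the context (it does not use knowledge of $s$ or $L$). Then for every $s\in(s_{\min},s_{\max})$ there is a constant $C>0$, not depending on $n$ and $m$, such that $$\sup_{f_0\in B^s_{2,\infty}(L)}E_{f_0}\big\|\hat f_n-f_0\big\|_2^2\le C\,n^{-2s/(1+2s)}.$$
   Context: Model. Let $\{\psi_{ij}: i\ge 0,\ j=0,\dots,2^i-1\}$ be a fixed orthonormal (boundary-corrected Cohen–Daubechies–Vial) wavelet basis of $L^2[0,1]$, and write $f_0=\sum_{i\ge0}\sum_{j=0}^{2^i-1}\theta_{0,ij}\psi_{ij}$; $\|\cdot\|_2$ is the $L^2[0,1]$ norm. In the distributed signal-in-white-noise model with $m$ machines and total sample size (signal-to-noise parameter) $n$, machine $k\in\{1,\dots,m\}$ observes $$y_{ij}^{(k)}=\theta_{0,ij}+\sqrt{\tfrac mn}\,Z_{ij}^{(k)},\qquad i\ge0,\ j=0,\dots,2^i-1,$$ with $Z_{ij}^{(k)}$ i.i.d. $N(0,1)$ over all $i,j,k$. $P_{f_0},E_{f_0}$ denote probability and expectation under this model. Besov ball. $f_0\in B^s_{2,\infty}(L)$ means that its coefficient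 sequence $\theta_0$ is in $\ell_2$ and $\sup_{i\ge0}2^{2is}\sum_{j=0}^{2^i-1}\theta_{0,ij}^2\le L$. Truncation level. Put $T_i^{(k)}=2^{-i}\sum_{j=0}^{2^i-1}(y_{ij}^{(k)})^2$, $T_i=\frac1m\sum_{k=1}^mT_i^{(k)}$ and $\widetilde T_i=2^iT_i-2^i m/n$. Let $\mathcal L$ be the set of integers in $\big[\frac{\log_2 n}{1+2s_{\max}},\frac{\log_2 n}{1+2s_{\min}}\big]$. Define $$\hat\ell=\min\Big\{\ell\in\mathcal L:\ \sum_{i=\ell}^{l}\widetilde T_i\le \tau 2^l/n\ \text{ for all } l\in\mathcal L,\ l\ge\ell\Big\},$$ with $\hat\ell=\lfloor\log_2(n)/(1+2s_{\min})\rfloor$ if this set is empty. *)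

theory Defs
  imports "HOL-Probability.Probability"
begin

abbreviation unit_leb :: "real measure" where
  "unit_leb \<equiv> lebesgue_on {0..1}"

definition L2_space :: "(real \<Rightarrow> real) set" where
  "L2_space = {f. f \<in> borel_measurable unit_leb \<and> integrable unit_leb (\<lambda>x. (f x)\<^sup>2)}"

definition L2_inner :: "(real \<Rightarrow> real) \<Rightarrow> (real \<Rightarrow> real) \<Rightarrow> real" where
  "L2_inner f g = (\<integral>x. f x * g x \<partial>unit_leb)"

definition L2_norm :: "(real \<Rightarrow> real) \<Rightarrow> real" where
  "L2_norm f = sqrt (\<integral>x. (f x)\<^sup>2 \<partial>unit_leb)"

definition coeff_index :: "(nat \<times> nat) set" where
  "coeff_index = (SIGMA i:UNIV. {..<2 ^ i})"

text \<open>
  An orthonormal basis of the real space $L^2[0,1]$ in the dyadic double indexing of a wavelet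
  basis. Functions are representatives of $L^2$ classes. The boundary-corrected
  Cohen--Daubechies--Vial bases are instances; the model, the Besov ball and the loss
  involve the basis only through its being orthonormal and complete, so the form of the
  individual wavelets is not part of the definition.
\<close>
definition orthonormal_basis_L2 :: "(nat \<Rightarrow> nat \<Rightarrow> real \<Rightarrow> real) \<Rightarrow> bool" where
  "orthonormal_basis_L2 \<psi> \<longleftrightarrow>
     (\<forall>(i, j) \<in> coeff_index. \<psi> i j \<in> L2_space) \<and>
     (\<forall>(i, j) \<in> coeff_index. \<forall>(i', j') \<in> coeff_index.
        L2_inner (\<psi> i j) (\<psi> i' j') = (if (i, j) = (i', j') then 1 else 0)) \<and>
     (\<forall>f \<in> L2_space.
        (\<lambda>N. L2_norm (\<lambda>x. f x - (\<Sum>i<N. \<Sum>j<2 ^ i. L2_inner f (\<psi> i j) * \<psi> i j x)))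
          \<longlonglongrightarrow> 0)"

definition coeff :: "(nat \<Rightarrow> nat \<Rightarrow> real \<Rightarrow> real) \<Rightarrow> (real \<Rightarrow> real) \<Rightarrow> nat \<Rightarrow> nat \<Rightarrow> real" where
  "coeff \<psi> f i j = L2_inner f (\<psi> i j)"

definition besov_ball ::
  "(nat \<Rightarrow> nat \<Rightarrow> real \<Rightarrow> real) \<Rightarrow> real \<Rightarrow> real \<Rightarrow> (real \<Rightarrow> real) set" where
  "besov_ball \<psi> s L = {f \<in> L2_space.
     (\<lambda>(i, j). (coeff \<psi> f i j)\<^sup>2) summable_on coeff_index \<and>
     (SUP i. ennreal (2 powr (2 * real i * s) * (\<Sum>j<2 ^ i. (coeff \<psi> f i j)\<^sup>2))) \<le> ennreal L}"

text \<open>The arguments of \<open>Z\<close> and of the data \<open>y\<close> are, in this order, machine \<open>k\<close>, level \<open>i\<close>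
  and location \<open>j\<close>; machines are numbered from 1 to \<open>m\<close>.\<close>

definition white_noise :: "'w measure \<Rightarrow> nat \<Rightarrow> (nat \<Rightarrow> nat \<Rightarrow> nat \<Rightarrow> 'w \<Rightarrow> real) \<Rightarrow> bool" where
  "white_noise M m Z \<longleftrightarrow>
     prob_space M \<and>
     prob_space.indep_vars M (\<lambda>_. borel) (\<lambda>(k, i, j). Z k i j) ({1..m} \<times> coeff_index) \<and>
     (\<forall>k \<in> {1..m}. \<forall>(i, j) \<in> coeff_index.
        distributed M lborel (Z k i j) (\<lambda>x. ennreal (std_normal_density x)))"

definition observation ::
  "nat \<Rightarrow> nat \<Rightarrow> (nat \<Rightarrow> nat \<Rightarrow> real) \<Rightarrow> (nat \<Rightarrow> nat \<Rightarrow> nat \<Rightarrow> 'w \<Rightarrow> real) \<Rightarrow>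
     'w \<Rightarrow> nat \<Rightarrow> nat \<Rightarrow> nat \<Rightarrow> real" where
  "observation n m \<theta> Z \<omega> k i j = \<theta> i j + sqrt (real m / real n) * Z k i j \<omega>"

definition T_local :: "(nat \<Rightarrow> nat \<Rightarrow> nat \<Rightarrow> real) \<Rightarrow> nat \<Rightarrow> nat \<Rightarrow> real" where
  "T_local y k i = (\<Sum>j<2 ^ i. (y k i j)\<^sup>2) / 2 ^ i"

definition T_avg :: "nat \<Rightarrow> (nat \<Rightarrow> nat \<Rightarrow> nat \<Rightarrow> real) \<Rightarrow> nat \<Rightarrow> real" where
  "T_avg m y i = (\<Sum>k=1..m. T_local y k i) / real m"

definition T_tilde :: "nat \<Rightarrow> nat \<Rightarrow> (nat \<Rightarrow> nat \<Rightarrow> nat \<Rightarrow> real) \<Rightarrow> nat \<Rightarrow> real" where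
  "T_tilde n m y i = 2 ^ i * T_avg m y i - 2 ^ i * real m / real n"

text \<open>Only used for \<open>n \<ge> 1\<close>, where every integer in the interval is nonnegative, so that
  levels can be taken in \<open>nat\<close>.\<close>
definition levels :: "real \<Rightarrow> real \<Rightarrow> nat \<Rightarrow> nat set" where
  "levels smin smax n =
     {l. log 2 (real n) / (1 + 2 * smax) \<le> real l \<and> real l \<le> log 2 (real n) / (1 + 2 * smin)}"

definition admissible_levels ::
  "real \<Rightarrow> real \<Rightarrow> real \<Rightarrow> nat \<Rightarrow> nat \<Rightarrow> (nat \<Rightarrow> nat \<Rightarrow> nat \<Rightarrow> real) \<Rightarrow> nat set" where
  "admissible_levels smin smax \<tau> n m y =
     {l \<in> levels smin smax n. \<forall>l' \<in> levels smin smax n. l \<le> l' \<longrightarrow>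
        (\<Sum>i=l..l'. T_tilde n m y i) \<le> \<tau> * 2 ^ l' / real n}"

definition trunc_level ::
  "real \<Rightarrow> real \<Rightarrow> real \<Rightarrow> nat \<Rightarrow> nat \<Rightarrow> (nat \<Rightarrow> nat \<Rightarrow> nat \<Rightarrow> real) \<Rightarrow> nat" where
  "trunc_level smin smax \<tau> n m y =
     (if admissible_levels smin smax \<tau> n m y = {}
      then nat \<lfloor>log 2 (real n) / (1 + 2 * smin)\<rfloor>
      else Min (admissible_levels smin smax \<tau> n m y))"

definition estimator ::
  "(nat \<Rightarrow> nat \<Rightarrow> real \<Rightarrow> real) \<Rightarrow> real \<Rightarrow> real \<Rightarrow> real \<Rightarrow> nat \<Rightarrow> nat \<Rightarrow>
     (nat \<Rightarrow> nat \<Rightarrow> nat \<Rightarrow> real) \<Rightarrow> real \<Rightarrow> real" where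
  "estimator \<psi> smin smax \<tau> n m y x =
     (\<Sum>i\<le>trunc_level smin smax \<tau> n m y. \<Sum>j<2 ^ i.
        ((\<Sum>k=1..m. y k i j) / real m) * \<psi> i j x)"

text \<open>The expectation is taken as a nonnegative integral, so that an infinite risk is not
  mistaken for zero.\<close>
definition risk ::
  "'w measure \<Rightarrow> (nat \<Rightarrow> nat \<Rightarrow> nat \<Rightarrow> 'w \<Rightarrow> real) \<Rightarrow> (nat \<Rightarrow> nat \<Rightarrow> real \<Rightarrow> real) \<Rightarrow>
     real \<Rightarrow> real \<Rightarrow> real \<Rightarrow> nat \<Rightarrow> nat \<Rightarrow> (real \<Rightarrow> real) \<Rightarrow> ennreal" where
  "risk M Z \<psi> smin smax \<tau> n m f =
     (\<integral>\<^sup>+\<omega>. ennreal ((L2_norm (\<lambda>x.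
        estimator \<psi> smin smax \<tau> n m (observation n m (coeff \<psi> f) Z \<omega>) x - f x))\<^sup>2) \<partial>M)"

end

theory Submission
  imports Defs
begin

text \<open>
  Average the noise over the machines to \<open>W i j = (\<Sum>k. Z k i j) / sqrt m\<close>, again standard normal, and put
  \<open>S i = \<Sum>j. (W i j)\<^sup>2\<close> and \<open>U i = \<Sum>j k. ((Z k i j)\<^sup>2 - 1)\<close>. The statistic at level \<open>i\<close> is the signal energy
  plus \<open>U i / n\<close> plus a cross term that AM-GM absorbs into the signal energy and \<open>S i / n\<close>.
  Compare the random level with an oracle level \<open>l0\<close>, \<open>2 ^ l0 \<approx> n powr (1 / (1 + 2 * s))\<close>.

  If the procedure stops before \<open>l0\<close>, the test passed at \<open>l0\<close>, and the passed test itself bounds the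
  signal energy that was cut off between the two levels by a multiple of \<open>2 ^ l0 / n\<close>.

  If it reaches a level \<open>i > l0\<close>, the test failed at \<open>i - 1\<close>, where the signal is negligible, so a centred
  chi-square sum over levels \<open>i - 1, \<dots>, l'\<close> exceeds a multiple of \<open>2 ^ l'\<close>; by Chebyshev this
  has probability of order \<open>m / 2 ^ l'\<close>. Since \<open>S i \<le> 2 * 2 ^ i + (S i - 2 ^ i)\<^sup>2 / (4 * 2 ^ i)\<close>, level \<open>i\<close>
  then adds \<open>O(m / n)\<close> to the risk. The resulting total \<open>O(m * log n / n)\<close> is of smaller order because \<open>m\<close> is at most
  \<open>n powr (1 / (1 + 2 * smax))\<close> and \<open>s < smax\<close>.
\<close>

section \<open>Chi-square moments\<close>

text \<open>Variances of independent centred variables add: in the induction step the new variable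
  is independent of the sum of the others, so the expected cross product factors and vanishes. First
  powers are integrable because the measure is finite and the squares are integrable.\<close>

lemma (in prob_space) second_moment_sum_indep:
  fixes X :: "'i \<Rightarrow> 'a \<Rightarrow> real"
  assumes "finite A" "indep_vars (\<lambda>_. borel) X A"
    and "\<And>a. a \<in> A \<Longrightarrow> integrable M (\<lambda>\<omega>. (X a \<omega>)\<^sup>2)"
    and "\<And>a. a \<in> A \<Longrightarrow> expectation (X a) = 0"
  shows "integrable M (\<lambda>\<omega>. (\<Sum>a\<in>A. X a \<omega>)\<^sup>2)"
    and "expectation (\<lambda>\<omega>. (\<Sum>a\<in>A. X a \<omega>)\<^sup>2) = (\<Sum>a\<in>A. expectation (\<lambda>\<omega>. (X a \<omega>)\<^sup>2))"
proof -
  have "integrable M (\<lambda>\<omega>. (\<Sum>a\<in>A. X a \<omega>)\<^sup>2) \<and>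
    expectation (\<lambda>\<omega>. (\<Sum>a\<in>A. X a \<omega>)\<^sup>2) = (\<Sum>a\<in>A. expectation (\<lambda>\<omega>. (X a \<omega>)\<^sup>2))"
    using assms
  proof (induction A rule: finite_induct)
    case empty
    then show ?case by simp
  next
    case (insert x F)
    define S where "S \<omega> = (\<Sum>a\<in>F. X a \<omega>)" for \<omega>
    have rv [measurable]: "X a \<in> borel_measurable M" if "a \<in> insert x F" for a
      using insert.prems(1) that by (auto simp: indep_vars_def)
    have meas_S [measurable]: "S \<in> borel_measurable M"
      unfolding S_def using rv by (intro borel_measurable_sum) auto
    have IH: "integrable M (\<lambda>\<omega>. (S \<omega>)\<^sup>2)"
      "expectation (\<lambda>\<omega>. (S \<omega>)\<^sup>2) = (\<Sum>a\<in>F. expectation (\<lambda>\<omega>. (X a \<omega>)\<^sup>2))"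
      using insert.IH indep_vars_subset[OF insert.prems(1), of F] insert.prems(2,3)
      by (auto simp: S_def)
    have "indep_var borel (X x) borel S"
      unfolding S_def using insert.hyps insert.prems(1) by (rule indep_vars_sum)
    moreover have ix: "integrable M (X x)"
      by (rule square_integrable_imp_integrable[OF rv insert.prems(2)]) auto
    moreover have iS: "integrable M S"
      by (rule square_integrable_imp_integrable[OF meas_S IH(1)])
    ultimately have cross: "integrable M (\<lambda>\<omega>. X x \<omega> * S \<omega>)" "expectation (\<lambda>\<omega>. X x \<omega> * S \<omega>) = 0"
      using insert.prems(3)[of x] by (auto simp: indep_var_integrable indep_var_lebesgue_integral)
    have sq: "(\<Sum>a\<in>insert x F. X a \<omega>)\<^sup>2 = (X x \<omega>)\<^sup>2 + (S \<omega>)\<^sup>2 + 2 * (X x \<omega> * S \<omega>)" for \<omega>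
      using insert.hyps by (simp add: S_def power2_sum)
    have sqx: "integrable M (\<lambda>\<omega>. (X x \<omega>)\<^sup>2)"
      using insert.prems(2) by auto
    show ?case
      unfolding sq using insert.hyps sqx IH cross by simp
  qed
  then show "integrable M (\<lambda>\<omega>. (\<Sum>a\<in>A. X a \<omega>)\<^sup>2)"
    and "expectation (\<lambda>\<omega>. (\<Sum>a\<in>A. X a \<omega>)\<^sup>2) = (\<Sum>a\<in>A. expectation (\<lambda>\<omega>. (X a \<omega>)\<^sup>2))"
    by auto
qed

lemma (in prob_space) std_normal_square_moments:
  assumes X: "distributed M lborel X std_normal_density"
  shows "integrable M (\<lambda>\<omega>. (X \<omega>)\<^sup>2)" and "expectation (\<lambda>\<omega>. (X \<omega>)\<^sup>2) = 1"
    and "integrable M (\<lambda>\<omega>. ((X \<omega>)\<^sup>2 - 1)\<^sup>2)" and "expectation (\<lambda>\<omega>. ((X \<omega>)\<^sup>2 - 1)\<^sup>2) = 2"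
proof -
  \<comment> \<open>The even-moment formula gives 1 for \<open>k = 1\<close> and 3 for
    \<open>k = 2\<close>, so the centred square has second moment
    \<open>3 - 2 + 1 = 2\<close>.\<close>
  have mom: "integrable M (\<lambda>\<omega>. X \<omega> ^ (2 * k)) \<and>
      expectation (\<lambda>\<omega>. X \<omega> ^ (2 * k)) = fact (2 * k) / (2 ^ k * fact k)" for k
    using distributed_integrable[OF X, of "\<lambda>x. x ^ (2 * k)"]
      distributed_integral[OF X, of "\<lambda>x. x ^ (2 * k)"] std_normal_moment_even[of k]
    by (auto simp: has_bochner_integral_iff)
  show i2: "integrable M (\<lambda>\<omega>. (X \<omega>)\<^sup>2)" and e2: "expectation (\<lambda>\<omega>. (X \<omega>)\<^sup>2) = 1"
    using mom[of 1] by simp_all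
  have i4: "integrable M (\<lambda>\<omega>. (X \<omega>) ^ 4)" and e4: "expectation (\<lambda>\<omega>. (X \<omega>) ^ 4) = 3"
    using mom[of 2] by (simp_all add: fact_numeral)
  have sq: "((X \<omega>)\<^sup>2 - 1)\<^sup>2 = X \<omega> ^ 4 - 2 * (X \<omega>)\<^sup>2 + 1" for \<omega>
    by (simp add: power2_eq_square power4_eq_xxxx algebra_simps)
  show "integrable M (\<lambda>\<omega>. ((X \<omega>)\<^sup>2 - 1)\<^sup>2)" "expectation (\<lambda>\<omega>. ((X \<omega>)\<^sup>2 - 1)\<^sup>2) = 2"
    unfolding sq using i2 i4 e2 e4 by (simp_all add: prob_space)
qed

text \<open>The centred squares are again independent with mean 0, and each contributes variance
  2.\<close>

lemma (in prob_space) centered_chi_square_moments: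
  assumes "finite A" "indep_vars (\<lambda>_. borel) X A"
    and dist: "\<And>a. a \<in> A \<Longrightarrow> distributed M lborel (X a) std_normal_density"
  shows "integrable M (\<lambda>\<omega>. (\<Sum>a\<in>A. (X a \<omega>)\<^sup>2 - 1)\<^sup>2)"
    and "expectation (\<lambda>\<omega>. (\<Sum>a\<in>A. (X a \<omega>)\<^sup>2 - 1)\<^sup>2) = 2 * real (card A)"
proof -
  note moments = std_normal_square_moments[OF dist]
  have ind: "indep_vars (\<lambda>_. borel) (\<lambda>a \<omega>. (X a \<omega>)\<^sup>2 - 1) A"
    by (rule indep_vars_compose2[OF assms(2)]) auto
  show "integrable M (\<lambda>\<omega>. (\<Sum>a\<in>A. (X a \<omega>)\<^sup>2 - 1)\<^sup>2)"
    using moments by (intro second_moment_sum_indep(1)[OF assms(1) ind]) (auto simp: prob_space)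
  have "expectation (\<lambda>\<omega>. (\<Sum>a\<in>A. (X a \<omega>)\<^sup>2 - 1)\<^sup>2) = (\<Sum>a\<in>A. 2)"
    using moments by (subst second_moment_sum_indep(2)[OF assms(1) ind]) (auto simp: prob_space)
  then show "expectation (\<lambda>\<omega>. (\<Sum>a\<in>A. (X a \<omega>)\<^sup>2 - 1)\<^sup>2) = 2 * real (card A)"
    by simp
qed

section \<open>Noise pooled over the machines\<close>

definition pooled_noise :: "nat \<Rightarrow> (nat \<Rightarrow> nat \<Rightarrow> nat \<Rightarrow> 'w \<Rightarrow> real) \<Rightarrow> 'w \<Rightarrow> nat \<Rightarrow> nat \<Rightarrow> real" where
  "pooled_noise m Z \<omega> i j = (\<Sum>k=1..m. Z k i j \<omega>) / sqrt (real m)"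

definition pooled_energy :: "nat \<Rightarrow> (nat \<Rightarrow> nat \<Rightarrow> nat \<Rightarrow> 'w \<Rightarrow> real) \<Rightarrow> 'w \<Rightarrow> nat \<Rightarrow> real" where
  "pooled_energy m Z \<omega> i = (\<Sum>j<2 ^ i. (pooled_noise m Z \<omega> i j)\<^sup>2)"

text \<open>A centred chi-square with \<open>m * 2 ^ i\<close> degrees of freedom. It comes from
  squaring before averaging, so its variance carries the factor \<open>m\<close>; this is how the
  number of machines enters the risk.\<close>

definition local_excess :: "nat \<Rightarrow> (nat \<Rightarrow> nat \<Rightarrow> nat \<Rightarrow> 'w \<Rightarrow> real) \<Rightarrow> 'w \<Rightarrow> nat \<Rightarrow> real" where
  "local_excess m Z \<omega> i = (\<Sum>j<2 ^ i. \<Sum>k=1..m. (Z k i j \<omega>)\<^sup>2 - 1)"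

abbreviation block :: "nat set \<Rightarrow> (nat \<times> nat) set" where
  "block I \<equiv> (SIGMA i:I. {..<2 ^ i})"

lemma block_subset_coeff_index: "block I \<subseteq> coeff_index"
  by (auto simp: coeff_index_def)

lemma sum_block: "finite I \<Longrightarrow> (\<Sum>i\<in>I. \<Sum>j<2 ^ i. h i j) = (\<Sum>(i, j)\<in>block I. h i j)"
  by (simp add: sum.Sigma)

lemma pooled_noise_indep_normal:
  fixes M :: "'w measure"
  assumes wn: "white_noise M m Z" and m: "1 \<le> m"
  shows "prob_space.indep_vars M (\<lambda>_. borel) (\<lambda>(i, j) \<omega>. pooled_noise m Z \<omega> i j) coeff_index"
    and "(i, j) \<in> coeff_index \<Longrightarrow>
      distributed M lborel (\<lambda>\<omega>. pooled_noise m Z \<omega> i j) std_normal_density"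
proof -
  interpret prob_space M using wn by (simp add: white_noise_def)
  let ?X = "\<lambda>(k, i, j). Z k i j"
  have ind: "indep_vars (\<lambda>_. borel) ?X ({1..m} \<times> coeff_index)"
    using wn by (simp add: white_noise_def)
  \<comment> \<open>The block \<open>?K a\<close> collects the \<open>m\<close> variables at
    coefficient \<open>a\<close>. The blocks are disjoint, so functions of them stay
    independent.\<close>
  let ?K = "\<lambda>a. {1..m} \<times> {a}"
  have "indep_vars (\<lambda>a. PiM (?K a) (\<lambda>_. borel)) (\<lambda>a \<omega>. restrict (\<lambda>i. ?X i \<omega>) (?K a)) coeff_index"
    by (rule indep_vars_restrict[OF ind]) (auto simp: disjoint_family_on_def)
  then have "indep_vars (\<lambda>_. borel)
      (\<lambda>a \<omega>. (\<Sum>k=1..m. (restrict (\<lambda>i. ?X i \<omega>) (?K a)) (k, a)) / sqrt (real m)) coeff_index"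
    by (rule indep_vars_compose2)
      (auto intro!: borel_measurable_divide borel_measurable_sum measurable_component_singleton)
  then show "indep_vars (\<lambda>_. borel) (\<lambda>(i, j) \<omega>. pooled_noise m Z \<omega> i j) coeff_index"
    by (rule indep_vars_cong[THEN iffD1, rotated -1]) (auto simp: pooled_noise_def fun_eq_iff)
  assume ij: "(i, j) \<in> coeff_index"
  have dist: "distributed M lborel (Z k i j) (normal_density 0 1)" if "k \<in> {1..m}" for k
    using wn ij that by (auto simp: white_noise_def)
  have "indep_vars (\<lambda>_. borel) (\<lambda>k. Z k i j) {1..m}"
  proof -
    \<comment> \<open>Singleton blocks serve to reindex the family by \<open>k\<close> alone, with
      \<open>i\<close> and \<open>j\<close> fixed.\<close>
    have "indep_vars (\<lambda>k. PiM {(k, i, j)} (\<lambda>_. borel)) (\<lambda>k \<omega>. restrict (\<lambda>i. ?X i \<omega>) {(k, i, j)}) {1..m}"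
      using ij by (intro indep_vars_restrict[OF ind]) (auto simp: disjoint_family_on_def)
    then have "indep_vars (\<lambda>_. borel) (\<lambda>k \<omega>. (restrict (\<lambda>i. ?X i \<omega>) {(k, i, j)}) (k, i, j)) {1..m}"
      by (rule indep_vars_compose2) measurable
    then show ?thesis by (simp add: fun_eq_iff)
  qed
  then have "distributed M lborel (\<lambda>\<omega>. \<Sum>k=1..m. Z k i j \<omega>)
      (normal_density (\<Sum>k=1..m. 0) (sqrt (\<Sum>k=1..m. 1\<^sup>2)))"
    using m dist by (intro sum_indep_normal) auto
  then have "distributed M lborel (\<lambda>\<omega>. \<Sum>k=1..m. Z k i j \<omega>) (normal_density 0 (sqrt (real m)))"
    by simp
  then show "distributed M lborel (\<lambda>\<omega>. pooled_noise m Z \<omega> i j) std_normal_density"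
    using m by (subst (asm) normal_standard_normal_convert) (auto simp: pooled_noise_def)
qed

lemma pooled_energy_moments:
  fixes M :: "'w measure"
  assumes wn: "white_noise M m Z" and m: "1 \<le> m"
  shows "integrable M (\<lambda>\<omega>. pooled_energy m Z \<omega> i)"
    and "(\<integral>\<omega>. pooled_energy m Z \<omega> i \<partial>M) = 2 ^ i"
    and "finite I \<Longrightarrow> integrable M (\<lambda>\<omega>. (\<Sum>i\<in>I. pooled_energy m Z \<omega> i - 2 ^ i)\<^sup>2)"
    and "finite I \<Longrightarrow>
      (\<integral>\<omega>. (\<Sum>i\<in>I. pooled_energy m Z \<omega> i - 2 ^ i)\<^sup>2 \<partial>M) = 2 * (\<Sum>i\<in>I. 2 ^ i)"
proof -
  interpret prob_space M using wn by (simp add: white_noise_def)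
  note normal = pooled_noise_indep_normal(2)[OF wn m]
  note sq = std_normal_square_moments[OF normal]
  show "integrable M (\<lambda>\<omega>. pooled_energy m Z \<omega> i)" "expectation (\<lambda>\<omega>. pooled_energy m Z \<omega> i) = 2 ^ i"
    unfolding pooled_energy_def using sq
    by (auto simp: coeff_index_def intro!: Bochner_Integration.integrable_sum)
  assume I: "finite I"
  have eq: "(\<Sum>i\<in>I. pooled_energy m Z \<omega> i - 2 ^ i)
      = (\<Sum>a\<in>block I. ((\<lambda>(i, j) \<omega>. pooled_noise m Z \<omega> i j) a \<omega>)\<^sup>2 - 1)" for \<omega>
  proof -
    have "(\<Sum>i\<in>I. pooled_energy m Z \<omega> i - 2 ^ i)
        = (\<Sum>i\<in>I. \<Sum>j<2 ^ i. (pooled_noise m Z \<omega> i j)\<^sup>2 - 1)"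
      by (simp add: pooled_energy_def sum_subtractf)
    then show ?thesis
      using I by (simp add: sum_block case_prod_unfold)
  qed
  have chi: "finite (block I)"
      "indep_vars (\<lambda>_. borel) (\<lambda>(i, j) \<omega>. pooled_noise m Z \<omega> i j) (block I)"
      "\<And>a. a \<in> block I \<Longrightarrow>
        distributed M lborel ((\<lambda>(i, j) \<omega>. pooled_noise m Z \<omega> i j) a) std_normal_density"
    using I normal block_subset_coeff_index
    by (auto intro: indep_vars_subset[OF pooled_noise_indep_normal(1)[OF wn m]]
        simp: coeff_index_def)
  show "integrable M (\<lambda>\<omega>. (\<Sum>i\<in>I. pooled_energy m Z \<omega> i - 2 ^ i)\<^sup>2)"
    unfolding eq by (rule centered_chi_square_moments(1)[OF chi])
  show "(\<integral>\<omega>. (\<Sum>i\<in>I. pooled_energy m Z \<omega> i - 2 ^ i)\<^sup>2 \<partial>M) = 2 * (\<Sum>i\<in>I. 2 ^ i)"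
    unfolding eq using I by (subst centered_chi_square_moments(2)[OF chi]) auto
qed

lemma local_excess_moments:
  fixes M :: "'w measure"
  assumes wn: "white_noise M m Z" and I: "finite I"
  shows "integrable M (\<lambda>\<omega>. (\<Sum>i\<in>I. local_excess m Z \<omega> i)\<^sup>2)"
    and "(\<integral>\<omega>. (\<Sum>i\<in>I. local_excess m Z \<omega> i)\<^sup>2 \<partial>M) = 2 * real m * (\<Sum>i\<in>I. 2 ^ i)"
proof -
  interpret prob_space M using wn by (simp add: white_noise_def)
  \<comment> \<open>Machine, level and location form a single index set, with one degree of freedom
    per triple.\<close>
  have eq: "(\<Sum>i\<in>I. local_excess m Z \<omega> i)
      = (\<Sum>a\<in>{1..m} \<times> block I. ((\<lambda>(k, i, j). Z k i j) a \<omega>)\<^sup>2 - 1)" for \<omega>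
  proof -
    have "(\<Sum>i\<in>I. local_excess m Z \<omega> i) = (\<Sum>a\<in>block I. \<Sum>k=1..m. (Z k (fst a) (snd a) \<omega>)\<^sup>2 - 1)"
      unfolding local_excess_def using I by (simp add: sum_block case_prod_unfold)
    also have "\<dots> = (\<Sum>k=1..m. \<Sum>a\<in>block I. (Z k (fst a) (snd a) \<omega>)\<^sup>2 - 1)"
      by (rule sum.swap)
    finally show ?thesis
      using I by (simp add: sum.cartesian_product case_prod_unfold)
  qed
  have chi: "finite ({1..m} \<times> block I)"
      "indep_vars (\<lambda>_. borel) (\<lambda>(k, i, j). Z k i j) ({1..m} \<times> block I)"
      "\<And>a. a \<in> {1..m} \<times> block I \<Longrightarrow> distributed M lborel ((\<lambda>(k, i, j). Z k i j) a) std_normal_density"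
    using I wn block_subset_coeff_index
    by (auto simp: white_noise_def coeff_index_def elim!: indep_vars_subset)
  show "integrable M (\<lambda>\<omega>. (\<Sum>i\<in>I. local_excess m Z \<omega> i)\<^sup>2)"
    unfolding eq by (rule centered_chi_square_moments(1)[OF chi])
  show "(\<integral>\<omega>. (\<Sum>i\<in>I. local_excess m Z \<omega> i)\<^sup>2 \<partial>M) = 2 * real m * (\<Sum>i\<in>I. 2 ^ i)"
    unfolding eq using I
    by (subst centered_chi_square_moments(2)[OF chi]) (auto simp: card_cartesian_product)
qed

section \<open>Loss of a truncated expansion\<close>

lemma L2_space_borel: "f \<in> L2_space \<Longrightarrow> f \<in> borel_measurable unit_leb"
  and L2_space_square_integrable: "f \<in> L2_space \<Longrightarrow> integrable unit_leb (\<lambda>x. (f x)\<^sup>2)"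
  by (simp_all add: L2_space_def)

lemma L2_norm_square: "(L2_norm f)\<^sup>2 = (\<integral>x. (f x)\<^sup>2 \<partial>unit_leb)"
  by (simp add: L2_norm_def)

lemma L2_integrable_mult:
  assumes "f \<in> L2_space" "g \<in> L2_space"
  shows "integrable unit_leb (\<lambda>x. f x * g x)"
proof (rule Bochner_Integration.integrable_bound)
  show "integrable unit_leb (\<lambda>x. (f x)\<^sup>2 + (g x)\<^sup>2)"
    using assms by (simp add: L2_space_def)
  show "(\<lambda>x. f x * g x) \<in> borel_measurable unit_leb"
    using assms by (intro borel_measurable_times L2_space_borel)
  have "\<bar>a * b\<bar> \<le> a\<^sup>2 + b\<^sup>2" for a b :: real
    using sum_squares_bound[of "\<bar>a\<bar>" "\<bar>b\<bar>"]
      mult_nonneg_nonneg[OF abs_ge_zero[of a] abs_ge_zero[of b]]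
    unfolding abs_mult power2_abs by linarith
  then show "AE x in unit_leb. norm (f x * g x) \<le> norm ((f x)\<^sup>2 + (g x)\<^sup>2)"
    by simp
qed

lemma L2_space_add:
  assumes "f \<in> L2_space" "g \<in> L2_space"
  shows "(\<lambda>x. f x + g x) \<in> L2_space"
  using assms L2_integrable_mult[OF assms] L2_space_borel[OF assms(1)] L2_space_borel[OF assms(2)]
  by (auto simp: L2_space_def power2_sum mult.assoc intro!: borel_measurable_add)

lemma L2_space_scale: "f \<in> L2_space \<Longrightarrow> (\<lambda>x. c * f x) \<in> L2_space"
  by (auto simp: L2_space_def power_mult_distrib intro!: borel_measurable_times)

lemma L2_space_zero: "(\<lambda>x. 0) \<in> L2_space"
  by (simp add: L2_space_def)

lemma L2_space_sum: "(\<And>a. a \<in> A \<Longrightarrow> f a \<in> L2_space) \<Longrightarrow> (\<lambda>x. \<Sum>a\<in>A. f a x) \<in> L2_space"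
  by (induction A rule: infinite_finite_induct) (simp_all add: L2_space_zero L2_space_add)

lemma L2_norm_diff_square_le:
  assumes f: "f \<in> L2_space" and g: "g \<in> L2_space"
  shows "(L2_norm (\<lambda>x. f x - g x))\<^sup>2 \<le> 2 * (L2_norm f)\<^sup>2 + 2 * (L2_norm g)\<^sup>2"
proof -
  have fg: "(\<lambda>x. f x - g x) \<in> L2_space"
    using L2_space_add[OF f L2_space_scale[OF g, of "-1"]] by simp
  have pw: "(a - b)\<^sup>2 \<le> 2 * a\<^sup>2 + 2 * b\<^sup>2" for a b :: real
    using sum_squares_bound[of a "-b"] by (simp add: power2_diff)
  have "(\<integral>x. (f x - g x)\<^sup>2 \<partial>unit_leb) \<le> (\<integral>x. 2 * (f x)\<^sup>2 + 2 * (g x)\<^sup>2 \<partial>unit_leb)"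
    using L2_space_square_integrable[OF fg] f g pw
    by (intro integral_mono) (auto simp: L2_space_square_integrable)
  also have "\<dots> = 2 * (\<integral>x. (f x)\<^sup>2 \<partial>unit_leb) + 2 * (\<integral>x. (g x)\<^sup>2 \<partial>unit_leb)"
    using f g by (simp add: L2_space_square_integrable)
  finally show ?thesis by (simp add: L2_norm_square)
qed

text \<open>Finite Parseval identity: expand the square into a double sum, of which orthonormality
  keeps the diagonal.\<close>

lemma orthonormal_combination_norm:
  assumes onb: "orthonormal_basis_L2 \<psi>" and I: "finite I"
  shows "(L2_norm (\<lambda>x. \<Sum>i\<in>I. \<Sum>j<2 ^ i. d i j * \<psi> i j x))\<^sup>2 = (\<Sum>i\<in>I. \<Sum>j<2 ^ i. (d i j)\<^sup>2)"
proof -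
  define e where "e = (\<lambda>a. \<psi> (fst a) (snd a))"
  define c where "c = (\<lambda>a. d (fst a) (snd a))"
  have e_L2: "e a \<in> L2_space" if "a \<in> block I" for a
    using onb that block_subset_coeff_index[of I]
    by (fastforce simp: orthonormal_basis_L2_def e_def)
  have inner: "(\<integral>x. e a x * e b x \<partial>unit_leb) = (if a = b then 1 else 0)"
    if "a \<in> block I" "b \<in> block I" for a b
  proof -
    have "a \<in> coeff_index" "b \<in> coeff_index"
      using that block_subset_coeff_index by blast+
    moreover have "\<forall>(i, j) \<in> coeff_index. \<forall>(i', j') \<in> coeff_index.
        L2_inner (\<psi> i j) (\<psi> i' j') = (if (i, j) = (i', j') then 1 else 0)"
      using onb by (simp add: orthonormal_basis_L2_def)
    ultimately show ?thesis
      by (cases a; cases b) (force simp: L2_inner_def e_def)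
  qed
  have fin: "finite (block I)" using I by simp
  have "(L2_norm (\<lambda>x. \<Sum>i\<in>I. \<Sum>j<2 ^ i. d i j * \<psi> i j x))\<^sup>2
      = (\<integral>x. (\<Sum>a\<in>block I. c a * e a x)\<^sup>2 \<partial>unit_leb)"
    using I by (simp add: L2_norm_square sum_block case_prod_unfold c_def e_def)
  also have "\<dots> = (\<integral>x. (\<Sum>a\<in>block I. \<Sum>b\<in>block I. c a * c b * (e a x * e b x)) \<partial>unit_leb)"
    unfolding power2_eq_square sum_product by (simp only: mult.assoc mult.left_commute)
  also have "\<dots> = (\<Sum>a\<in>block I. \<Sum>b\<in>block I. c a * c b * (\<integral>x. e a x * e b x \<partial>unit_leb))"
    using L2_integrable_mult[OF e_L2 e_L2]
    by (simp add: Bochner_Integration.integral_sum Bochner_Integration.integrable_sum)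
  also have "\<dots> = (\<Sum>a\<in>block I. \<Sum>b\<in>block I. if a = b then (c a)\<^sup>2 else 0)"
    using inner by (intro sum.cong refl) (auto simp: power2_eq_square)
  also have "\<dots> = (\<Sum>i\<in>I. \<Sum>j<2 ^ i. (d i j)\<^sup>2)"
    using I fin by (simp add: sum_block case_prod_unfold c_def)
  finally show ?thesis .
qed

text \<open>Compare with the partial sum of \<open>f\<close> over the levels below some
  \<open>N > K\<close>, where the finite Parseval identity applies, and let \<open>N\<close> tend to
  infinity; completeness makes the remainder vanish. The factor 2 comes from splitting the squared
  norm of a difference.\<close>

lemma truncated_expansion_error:
  assumes onb: "orthonormal_basis_L2 \<psi>" and f: "f \<in> L2_space"
    and tail: "\<And>N. (\<Sum>i\<in>{K<..<N}. \<Sum>j<2 ^ i. (coeff \<psi> f i j)\<^sup>2) \<le> b"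
  shows "(L2_norm (\<lambda>x. (\<Sum>i\<le>K. \<Sum>j<2 ^ i. c i j * \<psi> i j x) - f x))\<^sup>2
    \<le> 2 * ((\<Sum>i\<le>K. \<Sum>j<2 ^ i. (c i j - coeff \<psi> f i j)\<^sup>2) + b)"
proof -
  let ?r = "\<lambda>N x. f x - (\<Sum>i<N. \<Sum>j<2 ^ i. coeff \<psi> f i j * \<psi> i j x)"
  let ?V = "\<Sum>i\<le>K. \<Sum>j<2 ^ i. (c i j - coeff \<psi> f i j)\<^sup>2"
  have psi: "\<psi> i j \<in> L2_space" if "j < 2 ^ i" for i j
    using onb that by (auto simp: orthonormal_basis_L2_def coeff_index_def)
  have comb: "(\<lambda>x. \<Sum>i\<in>I. \<Sum>j<2 ^ i. d i j * \<psi> i j x) \<in> L2_space" for I d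
    using psi by (intro L2_space_sum L2_space_scale) auto
  have "(\<lambda>N. L2_norm (?r N)) \<longlonglongrightarrow> 0"
    using onb f by (simp add: orthonormal_basis_L2_def coeff_def)
  then have lim: "(\<lambda>N. 2 * (?V + b) + 2 * (L2_norm (?r N))\<^sup>2) \<longlonglongrightarrow> 2 * (?V + b) + 2 * 0\<^sup>2"
    by (intro tendsto_intros)
  have bound: "(L2_norm (\<lambda>x. (\<Sum>i\<le>K. \<Sum>j<2 ^ i. c i j * \<psi> i j x) - f x))\<^sup>2
      \<le> 2 * (?V + b) + 2 * (L2_norm (?r N))\<^sup>2" if N: "K < N" for N
  proof -
    \<comment> \<open>The fitted coefficients are padded with zeros above \<open>K\<close>, so that
      both expansions run over the same levels; above \<open>K\<close> the difference is minus the
      true coefficient.\<close>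
    define d where "d i j = (if i \<le> K then c i j else 0) - coeff \<psi> f i j" for i j
    have split: "{..<N} = {..K} \<union> {K<..<N}" "{..K} \<inter> {K<..<N} = {}" using N by auto
    have sum_d: "(\<Sum>i<N. h i) = (\<Sum>i\<le>K. h i) + (\<Sum>i\<in>{K<..<N}. h i)" for h :: "nat \<Rightarrow> real"
      unfolding split(1) by (rule sum.union_disjoint) (use split(2) in auto)
    have "(\<Sum>i\<le>K. \<Sum>j<2 ^ i. c i j * \<psi> i j x) = (\<Sum>i<N. \<Sum>j<2 ^ i. (if i \<le> K then c i j else 0) * \<psi> i j x)"
      for x by (simp add: sum_d)
    then have "(\<lambda>x. (\<Sum>i\<le>K. \<Sum>j<2 ^ i. c i j * \<psi> i j x) - f x)
        = (\<lambda>x. (\<Sum>i<N. \<Sum>j<2 ^ i. d i j * \<psi> i j x) - ?r N x)"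
      by (simp add: d_def left_diff_distrib sum_subtractf)
    moreover have "?r N \<in> L2_space"
      using L2_space_add[OF f L2_space_scale[OF comb[of "coeff \<psi> f" "{..<N}"], of "-1"]] by simp
    ultimately have "(L2_norm (\<lambda>x. (\<Sum>i\<le>K. \<Sum>j<2 ^ i. c i j * \<psi> i j x) - f x))\<^sup>2
        \<le> 2 * (L2_norm (\<lambda>x. \<Sum>i<N. \<Sum>j<2 ^ i. d i j * \<psi> i j x))\<^sup>2 + 2 * (L2_norm (?r N))\<^sup>2"
      using L2_norm_diff_square_le[OF comb] by simp
    moreover have "(L2_norm (\<lambda>x. \<Sum>i<N. \<Sum>j<2 ^ i. d i j * \<psi> i j x))\<^sup>2
        = ?V + (\<Sum>i\<in>{K<..<N}. \<Sum>j<2 ^ i. (coeff \<psi> f i j)\<^sup>2)"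
      by (subst orthonormal_combination_norm[OF onb finite_lessThan]) (simp add: sum_d, simp add: d_def)
    ultimately show ?thesis using tail[of N] by simp
  qed
  have "eventually (\<lambda>N. (L2_norm (\<lambda>x. (\<Sum>i\<le>K. \<Sum>j<2 ^ i. c i j * \<psi> i j x) - f x))\<^sup>2
      \<le> 2 * (?V + b) + 2 * (L2_norm (?r N))\<^sup>2) sequentially"
    using eventually_gt_at_top[of K] by eventually_elim (rule bound)
  from tendsto_lowerbound[OF lim this] show ?thesis by simp
qed

section \<open>The truncation level\<close>

definition level_energy :: "(nat \<Rightarrow> nat \<Rightarrow> real) \<Rightarrow> nat \<Rightarrow> real" where
  "level_energy \<theta> i = (\<Sum>j<2 ^ i. (\<theta> i j)\<^sup>2)"

lemma level_energy_nonneg: "0 \<le> level_energy \<theta> i"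
  by (simp add: level_energy_def sum_nonneg)

lemma pooled_energy_nonneg: "0 \<le> pooled_energy m Z \<omega> i"
  by (simp add: pooled_energy_def sum_nonneg)

section \<open>Decomposition of the level statistics\<close>

lemma observation_mean:
  assumes "1 \<le> n" "1 \<le> m"
  shows "(\<Sum>k=1..m. observation n m \<theta> Z \<omega> k i j) / real m
    = \<theta> i j + pooled_noise m Z \<omega> i j / sqrt (real n)"
proof -
  have "sqrt (real m) * sqrt (real m) = real m" by simp
  moreover have "(\<Sum>k=1..m. observation n m \<theta> Z \<omega> k i j)
      = real m * \<theta> i j + sqrt (real m / real n) * (\<Sum>k=1..m. Z k i j \<omega>)"
    by (simp add: observation_def sum.distrib sum_distrib_left)
  ultimately show ?thesis
    using assms by (simp add: pooled_noise_def real_sqrt_divide field_simps)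
qed

text \<open>The cross terms of the machines share the factor \<open>\<theta> i j\<close>, so only
  their pooled noise remains. The centring \<open>2 ^ i * m / n\<close> turns the sum of the squared
  noise variables into \<open>local_excess\<close>.\<close>

lemma T_tilde_observation:
  assumes n: "1 \<le> n" and m: "1 \<le> m"
  shows "T_tilde n m (observation n m \<theta> Z \<omega>) i = level_energy \<theta> i
    + (\<Sum>j<2 ^ i. 2 * \<theta> i j * (pooled_noise m Z \<omega> i j / sqrt (real n)))
    + local_excess m Z \<omega> i / real n"
proof -
  let ?y = "observation n m \<theta> Z \<omega>" and ?W = "pooled_noise m Z \<omega>"
  \<comment> \<open>Keeping one term linear in \<open>?y\<close> lets the average over machines be
    read off from \<open>observation_mean\<close>.\<close>
  have sq: "(?y k i j)\<^sup>2 = 2 * \<theta> i j * ?y k i j - (\<theta> i j)\<^sup>2 + real m / real n * (Z k i j \<omega>)\<^sup>2" for k j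
    by (simp add: observation_def power2_eq_square algebra_simps)
  have mean: "(\<Sum>k=1..m. (?y k i j)\<^sup>2) / real m = (\<theta> i j)\<^sup>2 + 2 * \<theta> i j * (?W i j / sqrt (real n))
      + (\<Sum>k=1..m. (Z k i j \<omega>)\<^sup>2) / real n" for j
  proof -
    have "(\<Sum>k=1..m. (?y k i j)\<^sup>2) = 2 * \<theta> i j * (\<Sum>k=1..m. ?y k i j) - real m * (\<theta> i j)\<^sup>2
        + real m / real n * (\<Sum>k=1..m. (Z k i j \<omega>)\<^sup>2)"
      unfolding sq by (simp add: sum.distrib sum_subtractf sum_distrib_left)
    then have "(\<Sum>k=1..m. (?y k i j)\<^sup>2) / real m
        = 2 * \<theta> i j * ((\<Sum>k=1..m. ?y k i j) / real m) - (\<theta> i j)\<^sup>2 + (\<Sum>k=1..m. (Z k i j \<omega>)\<^sup>2) / real n"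
      using n m by (simp add: field_simps)
    then show ?thesis
      unfolding observation_mean[OF n m] by (simp add: power2_eq_square algebra_simps)
  qed
  have "2 ^ i * T_avg m ?y i = (\<Sum>k=1..m. \<Sum>j<2 ^ i. (?y k i j)\<^sup>2) / real m"
    by (simp add: T_avg_def T_local_def sum_divide_distrib[symmetric])
  also have "\<dots> = (\<Sum>j<2 ^ i. (\<Sum>k=1..m. (?y k i j)\<^sup>2) / real m)"
    by (subst sum.swap) (simp add: sum_divide_distrib)
  finally show ?thesis
    unfolding mean using m n
    by (simp add: T_tilde_def level_energy_def local_excess_def sum.distrib sum_subtractf
        sum_divide_distrib[symmetric] diff_divide_distrib)
qed

text \<open>The weight \<open>a\<close> in AM-GM is left free: \<open>8 / \<tau>\<close> is used for
  the upper bound, where the pooled energy must fit under the threshold, and \<open>1 / 2\<close>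
  for the lower bound, where half of the signal energy must survive.\<close>

lemma T_tilde_approx:
  assumes n: "1 \<le> n" and m: "1 \<le> m" and a: "0 < a"
  shows "\<bar>T_tilde n m (observation n m \<theta> Z \<omega>) i - level_energy \<theta> i - local_excess m Z \<omega> i / real n\<bar>
    \<le> a * level_energy \<theta> i + pooled_energy m Z \<omega> i / (a * real n)"
proof -
  let ?W = "pooled_noise m Z \<omega>"
  have amgm: "\<bar>2 * x * y\<bar> \<le> a * x\<^sup>2 + y\<^sup>2 / a" for x y :: real
  proof -
    have "0 \<le> (a * \<bar>x\<bar> - \<bar>y\<bar>)\<^sup>2 / a" using a by simp
    also have "\<dots> = a * x\<^sup>2 + y\<^sup>2 / a - \<bar>2 * x * y\<bar>"
      using a by (simp add: power2_diff field_simps power2_eq_square abs_mult)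
    finally show ?thesis by simp
  qed
  have "\<bar>\<Sum>j<2 ^ i. 2 * \<theta> i j * (?W i j / sqrt (real n))\<bar>
      \<le> (\<Sum>j<2 ^ i. a * (\<theta> i j)\<^sup>2 + (?W i j / sqrt (real n))\<^sup>2 / a)"
    by (rule order_trans[OF sum_abs sum_mono[OF amgm]])
  also have "\<dots> = a * level_energy \<theta> i + pooled_energy m Z \<omega> i / (a * real n)"
    by (simp add: level_energy_def pooled_energy_def sum.distrib sum_distrib_left power_divide
        sum_divide_distrib mult.commute)
  finally show ?thesis by (simp add: T_tilde_observation[OF n m])
qed

section \<open>The selection rule\<close>

lemma finite_levels: "finite (levels smin smax n)"
  and levels_le: "l \<in> levels smin smax n \<Longrightarrow> l \<le> nat \<lfloor>log 2 (real n) / (1 + 2 * smin)\<rfloor>"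
proof -
  show *: "l \<le> nat \<lfloor>log 2 (real n) / (1 + 2 * smin)\<rfloor>" if "l \<in> levels smin smax n" for l
    using that by (simp add: levels_def le_nat_floor)
  show "finite (levels smin smax n)"
    by (rule finite_subset[of _ "{..nat \<lfloor>log 2 (real n) / (1 + 2 * smin)\<rfloor>}"]) (use * in auto)
qed

lemma finite_admissible: "finite (admissible_levels smin smax \<tau> n m y)"
  by (rule finite_subset[OF _ finite_levels[of smin smax n]]) (auto simp: admissible_levels_def)

lemma trunc_level_le:
  "trunc_level smin smax \<tau> n m y \<le> nat \<lfloor>log 2 (real n) / (1 + 2 * smin)\<rfloor>"
proof (cases "admissible_levels smin smax \<tau> n m y = {}")
  case False
  then have "trunc_level smin smax \<tau> n m y \<in> admissible_levels smin smax \<tau> n m y"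
    using Min_in[OF finite_admissible] by (simp add: trunc_level_def)
  then show ?thesis by (auto simp: admissible_levels_def intro!: levels_le)
qed (simp add: trunc_level_def)

text \<open>A value below some level of the grid cannot be the default, which is at least as large
  as every level. Hence the value is admissible, and its test holds at \<open>l\<close>.\<close>

lemma trunc_level_admissible:
  assumes "trunc_level smin smax \<tau> n m y < l" "l \<in> levels smin smax n"
  shows "(\<Sum>i=trunc_level smin smax \<tau> n m y..l. T_tilde n m y i) \<le> \<tau> * 2 ^ l / real n"
proof -
  have "admissible_levels smin smax \<tau> n m y \<noteq> {}"
    using assms levels_le[OF assms(2)] by (auto simp: trunc_level_def)
  then have "trunc_level smin smax \<tau> n m y \<in> admissible_levels smin smax \<tau> n m y"
    using Min_in[OF finite_admissible] by (simp add: trunc_level_def)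
  then show ?thesis using assms by (auto simp: admissible_levels_def)
qed

text \<open>By minimality \<open>l\<close> was rejected. If the default was taken, every level was
  rejected, so the claim covers that case too.\<close>

lemma below_trunc_level:
  assumes "l < trunc_level smin smax \<tau> n m y" "l \<in> levels smin smax n"
  shows "\<exists>l' \<in> levels smin smax n. l \<le> l' \<and> \<tau> * 2 ^ l' / real n < (\<Sum>i=l..l'. T_tilde n m y i)"
proof -
  have "l \<notin> admissible_levels smin smax \<tau> n m y"
    using assms(1) Min_le[OF finite_admissible, of l smin smax \<tau> n m y]
    by (auto simp: trunc_level_def split: if_splits)
  then show ?thesis using assms(2) by (auto simp: admissible_levels_def not_le)
qed

section \<open>Overshooting the oracle level\<close>

lemma sum_dyadic_le: "(\<Sum>i=l..l'. 2 ^ i) \<le> (2 * 2 ^ l' :: real)"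
proof -
  have "(\<Sum>i=l..l'. 2 ^ i) \<le> (\<Sum>i\<le>l'. 2 ^ i :: real)" by (rule sum_mono2) auto
  also have "\<dots> \<le> 2 * 2 ^ l'" by (induction l') auto
  finally show ?thesis by simp
qed

text \<open>A majorant of the indicator that the noise alone pushes the test statistic over the levels
  \<open>l, \<dots>, l'\<close> above its threshold, in the form given by Chebyshev's inequality.\<close>
definition exceedance ::
  "real \<Rightarrow> nat \<Rightarrow> (nat \<Rightarrow> nat \<Rightarrow> nat \<Rightarrow> 'w \<Rightarrow> real) \<Rightarrow> 'w \<Rightarrow> nat \<Rightarrow> nat \<Rightarrow> real" where
  "exceedance \<tau> m Z \<omega> l l' = (\<Sum>i=l..l'. pooled_energy m Z \<omega> i - 2 ^ i)\<^sup>2 / (4 * 4 ^ l')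
     + 16 * (\<Sum>i=l..l'. local_excess m Z \<omega> i)\<^sup>2 / (\<tau>\<^sup>2 * 4 ^ l')"

lemma exceedance_nonneg: "0 \<le> exceedance \<tau> m Z \<omega> l l'"
  by (simp add: exceedance_def)

text \<open>Of the threshold, one quarter is reserved for the signal and one quarter for the mean of
  the pooled energy, weighted by \<open>\<tau> / 8\<close>. The remaining half must be reached by
  \<open>\<tau> / 8 * D + U\<close>, so \<open>2 * 2 ^ l' \<le> D\<close> or
  \<open>\<tau> / 4 * 2 ^ l' \<le> U\<close>; the constants in \<open>exceedance\<close> make the
  matching term at least 1.\<close>

lemma exceedance_ge_1:
  assumes n: "1 \<le> n" and m: "1 \<le> m" and tau: "0 < \<tau>"
    and signal: "(1 + 8 / \<tau>) * (\<Sum>i=l..l'. level_energy \<theta> i) \<le> \<tau> / 4 * 2 ^ l' / real n"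
    and exceed: "\<tau> * 2 ^ l' / real n < (\<Sum>i=l..l'. T_tilde n m (observation n m \<theta> Z \<omega>) i)"
  shows "1 \<le> exceedance \<tau> m Z \<omega> l l'"
proof -
  define B where "B = (\<Sum>i=l..l'. level_energy \<theta> i)"
  define D where "D = (\<Sum>i=l..l'. pooled_energy m Z \<omega> i - 2 ^ i)"
  define U where "U = (\<Sum>i=l..l'. local_excess m Z \<omega> i)"
  have four: "(4::real) ^ l' = 2 ^ l' * 2 ^ l'" by (simp add: power_mult_distrib[symmetric])
  have "(\<Sum>i=l..l'. T_tilde n m (observation n m \<theta> Z \<omega>) i)
      \<le> (\<Sum>i=l..l'. (1 + 8 / \<tau>) * level_energy \<theta> i
          + pooled_energy m Z \<omega> i / (8 / \<tau> * real n) + local_excess m Z \<omega> i / real n)"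
  proof (rule sum_mono)
    fix i
    show "T_tilde n m (observation n m \<theta> Z \<omega>) i \<le> (1 + 8 / \<tau>) * level_energy \<theta> i
        + pooled_energy m Z \<omega> i / (8 / \<tau> * real n) + local_excess m Z \<omega> i / real n"
      using T_tilde_approx[OF n m, of "8 / \<tau>" \<theta> Z \<omega> i] tau by (simp add: distrib_right)
  qed
  also have "\<dots> = (1 + 8 / \<tau>) * B + (\<Sum>i=l..l'. pooled_energy m Z \<omega> i) / (8 / \<tau> * real n) + U / real n"
    by (simp only: B_def U_def sum.distrib sum_distrib_left sum_divide_distrib)
  also have "(\<Sum>i=l..l'. pooled_energy m Z \<omega> i) / (8 / \<tau> * real n) \<le> (D + 2 * 2 ^ l') / (8 / \<tau> * real n)"
    using sum_dyadic_le[of l l'] n tau by (intro divide_right_mono) (auto simp: D_def sum_subtractf)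
  finally have "\<tau> * 2 ^ l' / real n < \<tau> / 4 * 2 ^ l' / real n + (D + 2 * 2 ^ l') / (8 / \<tau> * real n) + U / real n"
    using exceed signal by (simp add: B_def)
  also have "\<dots> = (\<tau> / 4 * 2 ^ l' + \<tau> / 8 * (D + 2 * 2 ^ l') + U) / real n"
    using n tau by (simp add: field_simps)
  finally have "\<tau> * 2 ^ l' < \<tau> / 4 * 2 ^ l' + \<tau> / 8 * (D + 2 * 2 ^ l') + U"
    using n by (simp add: divide_less_cancel)
  then have key: "\<tau> / 2 * 2 ^ l' < \<tau> / 8 * D + U" by (simp add: algebra_simps)
  show ?thesis
  proof (cases "2 * 2 ^ l' \<le> D")
    case True
    then have "(2 * 2 ^ l')\<^sup>2 \<le> D\<^sup>2" by (intro power_mono) auto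
    then have "1 \<le> D\<^sup>2 / (4 * 4 ^ l')" by (simp add: four power2_eq_square)
    moreover have "0 \<le> 16 * U\<^sup>2 / (\<tau>\<^sup>2 * 4 ^ l')" by simp
    ultimately show ?thesis unfolding exceedance_def D_def[symmetric] U_def[symmetric] by linarith
  next
    case False
    then have "\<tau> / 8 * D \<le> \<tau> / 8 * (2 * 2 ^ l')" using tau by (intro mult_left_mono) auto
    then have "\<tau> / 4 * 2 ^ l' \<le> U" using key by simp
    then have "(\<tau> / 4 * 2 ^ l')\<^sup>2 \<le> U\<^sup>2" using tau by (intro power_mono) auto
    then have "1 \<le> 16 * U\<^sup>2 / (\<tau>\<^sup>2 * 4 ^ l')" using tau by (simp add: four power2_eq_square field_simps)
    moreover have "0 \<le> D\<^sup>2 / (4 * 4 ^ l')" by simp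
    ultimately show ?thesis unfolding exceedance_def D_def[symmetric] U_def[symmetric] by linarith
  qed
qed

text \<open>Bounds the pooled energy of a level \<open>i\<close> retained above the oracle level.
  The sum over \<open>l'\<close> is a union bound, since the endpoint at which the test at
  \<open>i - 1\<close> fails is random. The second term replaces the product of the energy with the
  selection event, which depends on the same noise.\<close>

definition level_overshoot ::
  "real \<Rightarrow> nat \<Rightarrow> (nat \<Rightarrow> nat \<Rightarrow> nat \<Rightarrow> 'w \<Rightarrow> real) \<Rightarrow> 'w \<Rightarrow> nat \<Rightarrow> nat \<Rightarrow> real" where
  "level_overshoot \<tau> m Z \<omega> q i = 2 * 2 ^ i * (\<Sum>l'=i-1..q. exceedance \<tau> m Z \<omega> (i - 1) l')
     + (pooled_energy m Z \<omega> i - 2 ^ i)\<^sup>2 / (4 * 2 ^ i)"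

lemma level_overshoot_nonneg: "0 \<le> level_overshoot \<tau> m Z \<omega> q i"
  by (auto simp: level_overshoot_def
      intro!: add_nonneg_nonneg mult_nonneg_nonneg sum_nonneg exceedance_nonneg)

lemma variance_bound:
  fixes \<theta> :: "nat \<Rightarrow> nat \<Rightarrow> real"
  assumes n: "1 \<le> n" and m: "1 \<le> m" and tau: "0 < \<tau>"
    and l0_large: "log 2 (real n) / (1 + 2 * smax) \<le> real l0"
    and signal: "\<And>l l'. l0 \<le> l \<Longrightarrow> l \<le> l' \<Longrightarrow>
      (1 + 8 / \<tau>) * (\<Sum>i=l..l'. level_energy \<theta> i) \<le> \<tau> / 4 * 2 ^ l' / real n"
    and q: "q = nat \<lfloor>log 2 (real n) / (1 + 2 * smin)\<rfloor>" and smin: "0 < smin"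
  shows "(\<Sum>i\<le>trunc_level smin smax \<tau> n m (observation n m \<theta> Z \<omega>). pooled_energy m Z \<omega> i)
    \<le> (\<Sum>i\<le>l0. pooled_energy m Z \<omega> i)
      + (\<Sum>i\<in>{l0<..q}. level_overshoot \<tau> m Z \<omega> q i)"
proof -
  let ?K = "trunc_level smin smax \<tau> n m (observation n m \<theta> Z \<omega>)"
  let ?S = "pooled_energy m Z \<omega>"
  let ?G = "level_overshoot \<tau> m Z \<omega> q"
  have S_le: "?S i \<le> ?G i" if i: "i \<in> {l0<..?K}" for i
  proof -
    \<comment> \<open>A level retained beyond \<open>l0\<close> has a predecessor that is at least
      \<open>l0\<close>, lies in the grid and was rejected.\<close>
    let ?l = "i - 1"
    have l: "l0 \<le> ?l" "?l < ?K" using i by auto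
    have "0 \<le> log 2 (real n)" using n by simp
    then have "real q \<le> log 2 (real n) / (1 + 2 * smin)"
      using smin unfolding q by (intro of_nat_floor) auto
    moreover have "?l \<le> q" using l trunc_level_le[of smin smax \<tau> n m] q by (meson less_imp_le le_trans)
    ultimately have "?l \<in> levels smin smax n"
      using l l0_large by (auto simp: levels_def intro: order_trans)
    then obtain l' where l': "l' \<in> levels smin smax n" "?l \<le> l'"
        "\<tau> * 2 ^ l' / real n < (\<Sum>i=?l..l'. T_tilde n m (observation n m \<theta> Z \<omega>) i)"
      using below_trunc_level l(2) by blast
    have "1 \<le> exceedance \<tau> m Z \<omega> ?l l'"
      using exceedance_ge_1[OF n m tau signal[OF l(1) l'(2)] l'(3)] .
    also have "\<dots> \<le> (\<Sum>l'=?l..q. exceedance \<tau> m Z \<omega> ?l l')"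
      using l' levels_le[OF l'(1)] q by (intro member_le_sum) (auto simp: exceedance_nonneg)
    finally have "2 * 2 ^ i * 1 \<le> 2 * 2 ^ i * (\<Sum>l'=?l..q. exceedance \<tau> m Z \<omega> ?l l')"
      by (intro mult_left_mono) auto
    moreover have "?S i \<le> 2 * 2 ^ i + (?S i - 2 ^ i)\<^sup>2 / (4 * 2 ^ i)"
    proof -
      \<comment> \<open>Only the mean \<open>2 ^ i\<close> is kept at first order; the fluctuation
        enters through its square, whose expectation is known.\<close>
      have "0 \<le> (?S i - 2 ^ i - 2 * 2 ^ i)\<^sup>2 / (4 * 2 ^ i)" by simp
      also have "\<dots> = (?S i - 2 ^ i)\<^sup>2 / (4 * 2 ^ i) - (?S i - 2 ^ i) + 2 ^ i"
        by (simp add: field_simps power2_eq_square)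
      finally show ?thesis by simp
    qed
    ultimately show ?thesis unfolding level_overshoot_def by linarith
  qed
  have "(\<Sum>i\<le>?K. ?S i) \<le> (\<Sum>i\<in>{..l0} \<union> {l0<..?K}. ?S i)"
    by (rule sum_mono2) (auto simp: pooled_energy_nonneg)
  also have "\<dots> = (\<Sum>i\<le>l0. ?S i) + (\<Sum>i\<in>{l0<..?K}. ?S i)"
    by (rule sum.union_disjoint) auto
  also have "(\<Sum>i\<in>{l0<..?K}. ?S i) \<le> (\<Sum>i\<in>{l0<..?K}. ?G i)"
    by (rule sum_mono) (rule S_le)
  \<comment> \<open>Replacing the random upper limit by the top of the grid frees the bound from the
    selected level.\<close>
  also have "\<dots> \<le> (\<Sum>i\<in>{l0<..q}. ?G i)"
    using trunc_level_le[of smin smax \<tau> n m "observation n m \<theta> Z \<omega>"] q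
    by (intro sum_mono2) (auto simp: level_overshoot_nonneg intro: le_trans)
  finally show ?thesis by simp
qed

section \<open>Signal energy cut off by the random level\<close>

lemma bias_bound:
  fixes \<theta> :: "nat \<Rightarrow> nat \<Rightarrow> real"
  assumes n: "1 \<le> n" and m: "1 \<le> m" and tau: "0 < \<tau>"
    and l0_large: "log 2 (real n) / (1 + 2 * smax) \<le> real l0"
    and q: "q = nat \<lfloor>log 2 (real n) / (1 + 2 * smin)\<rfloor>" and smin: "0 < smin"
    and tail: "\<And>N. (\<Sum>i\<in>{l0<..<N}. level_energy \<theta> i) \<le> b"
    and total: "\<And>N. q < l0 \<Longrightarrow> (\<Sum>i<N. level_energy \<theta> i) \<le> b"
  shows "(\<Sum>i\<in>{trunc_level smin smax \<tau> n m (observation n m \<theta> Z \<omega>)<..<N}. level_energy \<theta> i)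
    \<le> b + (2 * \<tau> * 2 ^ l0 + (\<Sum>i\<le>l0. 4 * pooled_energy m Z \<omega> i
        + (2 ^ i + (local_excess m Z \<omega> i)\<^sup>2 / 2 ^ i))) / real n" (is "_ \<le> b + ?R / real n")
proof -
  let ?K = "trunc_level smin smax \<tau> n m (observation n m \<theta> Z \<omega>)"
  let ?B = "level_energy \<theta>"
  define P where "P i = 4 * pooled_energy m Z \<omega> i + (2 ^ i + (local_excess m Z \<omega> i)\<^sup>2 / 2 ^ i)" for i
  have P_nonneg: "0 \<le> P i" for i
    by (simp add: P_def pooled_energy_nonneg)
  have R_nonneg: "0 \<le> ?R / real n"
    using tau by (auto simp: P_def[symmetric] P_nonneg
        intro!: divide_nonneg_nonneg add_nonneg_nonneg sum_nonneg)
  \<comment> \<open>In the first case the oracle level lies above the grid, where no test is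
    available, and \<open>b\<close> pays for the whole energy. In the second the cut-off part is
    contained in the oracle tail.\<close>
  consider "q < l0" | "l0 \<le> q" "l0 \<le> ?K" | "l0 \<le> q" "?K < l0" by linarith
  then show ?thesis
  proof cases
    case 1
    have "(\<Sum>i\<in>{?K<..<N}. ?B i) \<le> (\<Sum>i<N. ?B i)"
      by (rule sum_mono2) (auto simp: level_energy_nonneg)
    then show ?thesis using total[OF 1, of N] R_nonneg by linarith
  next
    case 2
    have "(\<Sum>i\<in>{?K<..<N}. ?B i) \<le> (\<Sum>i\<in>{l0<..<N}. ?B i)"
      using 2 by (intro sum_mono2) (auto simp: level_energy_nonneg)
    then show ?thesis using tail[of N] R_nonneg by linarith
  next
    case 3
    have "0 \<le> log 2 (real n)" using n by simp
    then have "real q \<le> log 2 (real n) / (1 + 2 * smin)"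
      using smin unfolding q by (intro of_nat_floor) auto
    then have "l0 \<in> levels smin smax n"
      using 3 l0_large by (auto simp: levels_def intro: order_trans[of _ "real q"])
    then have "(\<Sum>i=?K..l0. T_tilde n m (observation n m \<theta> Z \<omega>) i) \<le> \<tau> * 2 ^ l0 / real n"
      using trunc_level_admissible 3(2) by blast
    \<comment> \<open>Each statistic keeps at least half of its signal energy up to noise, so the
      passed test bounds the energy between \<open>?K\<close> and \<open>l0\<close>.\<close>
    moreover have "(\<Sum>i=?K..l0. ?B i / 2 - P i / 2 / real n)
        \<le> (\<Sum>i=?K..l0. T_tilde n m (observation n m \<theta> Z \<omega>) i)"
    proof (rule sum_mono)
      fix i
      \<comment> \<open>The lower limit \<open>?K\<close> is random, so the excess is bounded level
        by level. Its square over \<open>2 ^ i\<close> has expectation \<open>2 * m\<close>, which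
        costs order \<open>m\<close> per level.\<close>
      have "0 \<le> (\<bar>local_excess m Z \<omega> i\<bar> - 2 ^ i)\<^sup>2 / 2 ^ i" by simp
      also have "\<dots> = 2 ^ i + (local_excess m Z \<omega> i)\<^sup>2 / 2 ^ i - 2 * \<bar>local_excess m Z \<omega> i\<bar>"
        by (simp add: field_simps power2_eq_square)
      finally have "- local_excess m Z \<omega> i \<le> (2 ^ i + (local_excess m Z \<omega> i)\<^sup>2 / 2 ^ i) / 2" by simp
      then have "- local_excess m Z \<omega> i / real n
          \<le> (2 ^ i + (local_excess m Z \<omega> i)\<^sup>2 / 2 ^ i) / 2 / real n"
        by (rule divide_right_mono) simp
      then show "?B i / 2 - P i / 2 / real n \<le> T_tilde n m (observation n m \<theta> Z \<omega>) i"
        using T_tilde_approx[OF n m, of "1/2" \<theta> Z \<omega> i]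
        unfolding abs_le_iff P_def add_divide_distrib by simp
    qed
    moreover have "(\<Sum>i=?K..l0. ?B i / 2 - P i / 2 / real n)
        = (\<Sum>i=?K..l0. ?B i) / 2 - (\<Sum>i=?K..l0. P i) / 2 / real n"
      by (simp only: sum_subtractf sum_divide_distrib)
    ultimately have "(\<Sum>i=?K..l0. ?B i) \<le> (2 * \<tau> * 2 ^ l0 + (\<Sum>i=?K..l0. P i)) / real n"
      by (simp add: add_divide_distrib)
    also have "\<dots> \<le> ?R / real n"
      unfolding P_def[symmetric]
      by (intro divide_right_mono add_left_mono sum_mono2) (auto simp: P_nonneg)
    finally have "(\<Sum>i=?K..l0. ?B i) \<le> ?R / real n" .
    moreover have "(\<Sum>i\<in>{?K<..<N}. ?B i) \<le> (\<Sum>i\<in>{?K..l0} \<union> {l0<..<N}. ?B i)"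
      by (rule sum_mono2) (auto simp: level_energy_nonneg)
    moreover have "\<dots> = (\<Sum>i=?K..l0. ?B i) + (\<Sum>i\<in>{l0<..<N}. ?B i)"
      by (rule sum.union_disjoint) auto
    ultimately show ?thesis using tail[of N] by linarith
  qed
qed

section \<open>Risk\<close>

lemma sum_geometric_le:
  fixes r :: real
  assumes r: "0 \<le> r" "r < 1" and I: "finite I" "I \<subseteq> {l..}"
  shows "(\<Sum>i\<in>I. r ^ i) \<le> r ^ l / (1 - r)"
proof -
  obtain N where N: "I \<subseteq> {..<N}" using I(1) finite_nat_iff_bounded by auto
  have "(\<Sum>i=l..<l+k. r ^ i) * (1 - r) = r ^ l - r ^ (l + k)" for k
  proof (induction k)
    case (Suc k)
    have "(\<Sum>i=l..<l+Suc k. r ^ i) * (1 - r) = (\<Sum>i=l..<l+k. r ^ i) * (1 - r) + r ^ (l + k) * (1 - r)"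
      by (simp add: distrib_right)
    also have "\<dots> = r ^ l - r ^ (l + Suc k)"
      unfolding Suc.IH by (simp add: algebra_simps)
    finally show ?case .
  qed simp
  then have geo: "(\<Sum>i=l..<l+k. r ^ i) = (r ^ l - r ^ (l + k)) / (1 - r)" for k
    using r by (simp add: eq_divide_eq)
  have "(\<Sum>i\<in>I. r ^ i) \<le> (\<Sum>i=l..<l+N. r ^ i)"
    using N I(2) r by (intro sum_mono2) (auto simp: subset_iff trans_less_add2)
  also have "\<dots> \<le> r ^ l / (1 - r)"
    unfolding geo using r by (intro divide_right_mono) auto
  finally show ?thesis .
qed

text \<open>Both sums have variance dominated by the last level, of order \<open>2 ^ l'\<close> and
  \<open>m * 2 ^ l'\<close>; dividing by \<open>4 ^ l'\<close> leaves \<open>m / 2 ^ l'\<close>. The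
  pooled part is free of \<open>m\<close> and is absorbed using \<open>1 \<le> m\<close>.\<close>

lemma exceedance_expectation:
  fixes M :: "'w measure"
  assumes wn: "white_noise M m Z" and m: "1 \<le> m" and tau: "0 < \<tau>"
  shows "integrable M (\<lambda>\<omega>. exceedance \<tau> m Z \<omega> l l')"
    and "(\<integral>\<omega>. exceedance \<tau> m Z \<omega> l l' \<partial>M) \<le> (1 + 64 / \<tau>\<^sup>2) * real m * (1 / 2) ^ l'"
proof -
  note S = pooled_energy_moments(3,4)[OF wn m finite_atLeastAtMost[of l l']]
  note U = local_excess_moments[OF wn finite_atLeastAtMost[of l l']]
  show "integrable M (\<lambda>\<omega>. exceedance \<tau> m Z \<omega> l l')"
    unfolding exceedance_def using S(1) U(1) by simp
  have four: "(4::real) ^ l' = 2 ^ l' * 2 ^ l'" by (simp add: power_mult_distrib[symmetric])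
  have "(\<integral>\<omega>. exceedance \<tau> m Z \<omega> l l' \<partial>M)
      = (\<Sum>i=l..l'. 2 ^ i) * (2 / (4 * 4 ^ l') + 16 * (2 * real m) / (\<tau>\<^sup>2 * 4 ^ l'))"
    unfolding exceedance_def using S U by (simp add: algebra_simps)
  also have "\<dots> \<le> (2 * 2 ^ l') * (2 / (4 * 4 ^ l') + 16 * (2 * real m) / (\<tau>\<^sup>2 * 4 ^ l'))"
    by (intro mult_right_mono sum_dyadic_le) auto
  also have "\<dots> = (1 + 64 / \<tau>\<^sup>2 * real m) * (1 / 2) ^ l'"
    using tau by (simp add: four power_divide field_simps)
  also have "\<dots> \<le> (1 + 64 / \<tau>\<^sup>2) * real m * (1 / 2) ^ l'"
    using m by (intro mult_right_mono) (auto simp: distrib_right)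
  finally show "(\<integral>\<omega>. exceedance \<tau> m Z \<omega> l l' \<partial>M) \<le> (1 + 64 / \<tau>\<^sup>2) * real m * (1 / 2) ^ l'" .
qed

text \<open>The factor \<open>2 * 2 ^ i\<close> cancels against the geometric tail starting at
  \<open>i - 1\<close>, which leaves \<open>8 * ?c\<close> at every level. The fluctuation term adds
  \<open>1 / 2\<close>, absorbed by \<open>1 \<le> ?c\<close>.\<close>

lemma level_overshoot_expectation:
  fixes M :: "'w measure"
  assumes wn: "white_noise M m Z" and m: "1 \<le> m" and tau: "0 < \<tau>" and i: "1 \<le> i"
  shows "integrable M (\<lambda>\<omega>. level_overshoot \<tau> m Z \<omega> q i)"
    and "(\<integral>\<omega>. level_overshoot \<tau> m Z \<omega> q i \<partial>M) \<le> 9 * (1 + 64 / \<tau>\<^sup>2) * real m"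
proof -
  let ?c = "(1 + 64 / \<tau>\<^sup>2) * real m"
  note E = exceedance_expectation[OF wn m tau, of "i - 1"]
  have S: "integrable M (\<lambda>\<omega>. (pooled_energy m Z \<omega> i - 2 ^ i)\<^sup>2)"
    "(\<integral>\<omega>. (pooled_energy m Z \<omega> i - 2 ^ i)\<^sup>2 \<partial>M) = 2 * 2 ^ i"
    using pooled_energy_moments(3,4)[OF wn m, of "{i}"] by auto
  show "integrable M (\<lambda>\<omega>. level_overshoot \<tau> m Z \<omega> q i)"
    unfolding level_overshoot_def using E(1) S(1) by simp
  have "(\<integral>\<omega>. level_overshoot \<tau> m Z \<omega> q i \<partial>M)
      = 2 * 2 ^ i * (\<Sum>l'=i-1..q. (\<integral>\<omega>. exceedance \<tau> m Z \<omega> (i - 1) l' \<partial>M)) + 1 / 2"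
    unfolding level_overshoot_def using E(1) S by simp
  also have "(\<Sum>l'=i-1..q. (\<integral>\<omega>. exceedance \<tau> m Z \<omega> (i - 1) l' \<partial>M))
      \<le> (\<Sum>l'=i-1..q. ?c * (1 / 2) ^ l')"
    by (rule sum_mono) (rule E(2))
  also have "\<dots> \<le> ?c * ((1 / 2) ^ (i - 1) / (1 - 1 / 2))"
    unfolding sum_distrib_left[symmetric] by (intro mult_left_mono sum_geometric_le) auto
  also have "2 * 2 ^ i * (?c * ((1 / 2) ^ (i - 1) / (1 - 1 / 2))) = 8 * ?c"
    using i by (cases i) (auto simp: power_divide field_simps)
  finally have "(\<integral>\<omega>. level_overshoot \<tau> m Z \<omega> q i \<partial>M) \<le> 8 * ?c + 1 / 2" by simp
  moreover have "1 * 1 \<le> ?c"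
    using m by (intro mult_mono) auto
  ultimately show "(\<integral>\<omega>. level_overshoot \<tau> m Z \<omega> q i \<partial>M) \<le> 9 * (1 + 64 / \<tau>\<^sup>2) * real m"
    unfolding mult.assoc[of 9] by linarith
qed

text \<open>The loss is bounded for every outcome by \<open>H\<close>, which does not involve the
  selected level. Its expectation is then a sum of the moments above, with no conditioning on the
  selection.\<close>

lemma risk_bound:
  fixes M :: "'w measure"
  assumes onb: "orthonormal_basis_L2 \<psi>" and f: "f \<in> L2_space"
    and wn: "white_noise M m Z" and n: "1 \<le> n" and m: "1 \<le> m"
    and tau: "0 < \<tau>" and smin: "0 < smin"
    and l0_large: "log 2 (real n) / (1 + 2 * smax) \<le> real l0"
    and q: "q = nat \<lfloor>log 2 (real n) / (1 + 2 * smin)\<rfloor>"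
    and signal: "\<And>l l'. l0 \<le> l \<Longrightarrow> l \<le> l' \<Longrightarrow>
      (1 + 8 / \<tau>) * (\<Sum>i=l..l'. level_energy (coeff \<psi> f) i) \<le> \<tau> / 4 * 2 ^ l' / real n"
    and tail: "\<And>N. (\<Sum>i\<in>{l0<..<N}. level_energy (coeff \<psi> f) i) \<le> b"
    and total: "\<And>N. q < l0 \<Longrightarrow> (\<Sum>i<N. level_energy (coeff \<psi> f) i) \<le> b"
  shows "risk M Z \<psi> smin smax \<tau> n m f \<le> ennreal (2 * (b + ((12 + 2 * \<tau>) * 2 ^ l0
    + 9 * (1 + 64 / \<tau>\<^sup>2) * real m * real q + 2 * real m * (real l0 + 1)) / real n))"
proof -
  interpret prob_space M using wn by (simp add: white_noise_def)
  define V where "V \<omega> = (\<Sum>i\<le>l0. pooled_energy m Z \<omega> i) + (\<Sum>i\<in>{l0<..q}. level_overshoot \<tau> m Z \<omega> q i)" for \<omega>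
  define R where "R \<omega> = 2 * \<tau> * 2 ^ l0 + (\<Sum>i\<le>l0. 4 * pooled_energy m Z \<omega> i
        + (2 ^ i + (local_excess m Z \<omega> i)\<^sup>2 / 2 ^ i))" for \<omega>
  define H where "H \<omega> = 2 * (V \<omega> / real n + (b + R \<omega> / real n))" for \<omega>
  have loss: "(L2_norm (\<lambda>x. estimator \<psi> smin smax \<tau> n m (observation n m (coeff \<psi> f) Z \<omega>) x - f x))\<^sup>2
      \<le> H \<omega>" for \<omega>
  proof -
    let ?K = "trunc_level smin smax \<tau> n m (observation n m (coeff \<psi> f) Z \<omega>)"
    have "(L2_norm (\<lambda>x. estimator \<psi> smin smax \<tau> n m (observation n m (coeff \<psi> f) Z \<omega>) x - f x))\<^sup>2
        \<le> 2 * ((\<Sum>i\<le>?K. \<Sum>j<2 ^ i. (coeff \<psi> f i j + pooled_noise m Z \<omega> i j / sqrt (real n)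
              - coeff \<psi> f i j)\<^sup>2) + (b + R \<omega> / real n))"
      unfolding estimator_def observation_mean[OF n m] R_def
      by (rule truncated_expansion_error[OF onb f])
        (use bias_bound[OF n m tau l0_large q smin tail total] in \<open>simp add: level_energy_def\<close>)
    also have "(\<Sum>i\<le>?K. \<Sum>j<2 ^ i. (coeff \<psi> f i j + pooled_noise m Z \<omega> i j / sqrt (real n)
              - coeff \<psi> f i j)\<^sup>2) = (\<Sum>i\<le>?K. pooled_energy m Z \<omega> i) / real n"
      by (simp add: pooled_energy_def power_divide sum_divide_distrib)
    also have "\<dots> \<le> V \<omega> / real n"
      unfolding V_def
      by (intro divide_right_mono variance_bound[OF n m tau l0_large signal q smin]) auto
    finally show ?thesis by (simp add: H_def)
  qed
  have U: "integrable M (\<lambda>\<omega>. (local_excess m Z \<omega> i)\<^sup>2)"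
      "expectation (\<lambda>\<omega>. (local_excess m Z \<omega> i)\<^sup>2) = 2 * real m * 2 ^ i" for i
    using local_excess_moments[OF wn, of "{i}"] by auto
  note S = pooled_energy_moments(1,2)[OF wn m]
  note G = level_overshoot_expectation[OF wn m tau]
  have int_V: "integrable M V" and int_R: "integrable M R"
    unfolding V_def R_def using S(1) U(1) G(1)
    by (auto intro!: Bochner_Integration.integrable_add Bochner_Integration.integrable_sum
        integrable_divide)
  then have int_H: "integrable M H"
    unfolding H_def by (intro integrable_mult_right Bochner_Integration.integrable_add
        integrable_divide integrable_const) auto
  have dyadic: "(\<Sum>i\<le>l0. 2 ^ i) \<le> (2 * 2 ^ l0 :: real)"
    using sum_dyadic_le[of 0 l0] by (simp add: atLeast0AtMost)
  have "expectation V = (\<Sum>i\<le>l0. 2 ^ i) + (\<Sum>i\<in>{l0<..q}. expectation (\<lambda>\<omega>. level_overshoot \<tau> m Z \<omega> q i))"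
  proof -
    have "integrable M (\<lambda>\<omega>. \<Sum>i\<in>{l0<..q}. level_overshoot \<tau> m Z \<omega> q i)"
      using G(1) by (intro Bochner_Integration.integrable_sum) auto
    then have "expectation V = (\<Sum>i\<le>l0. 2 ^ i)
        + expectation (\<lambda>\<omega>. \<Sum>i\<in>{l0<..q}. level_overshoot \<tau> m Z \<omega> q i)"
      unfolding V_def using S by (simp add: Bochner_Integration.integrable_sum)
    also have "expectation (\<lambda>\<omega>. \<Sum>i\<in>{l0<..q}. level_overshoot \<tau> m Z \<omega> q i)
        = (\<Sum>i\<in>{l0<..q}. expectation (\<lambda>\<omega>. level_overshoot \<tau> m Z \<omega> q i))"
      using G(1) by (intro Bochner_Integration.integral_sum) auto
    finally show ?thesis .
  qed
  also have "(\<Sum>i\<in>{l0<..q}. expectation (\<lambda>\<omega>. level_overshoot \<tau> m Z \<omega> q i))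
      \<le> (\<Sum>i\<in>{l0<..q}. 9 * (1 + 64 / \<tau>\<^sup>2) * real m)"
    by (intro sum_mono G(2)) auto
  also have "\<dots> = 9 * (1 + 64 / \<tau>\<^sup>2) * real m * real (q - l0)"
    by simp
  also have "\<dots> \<le> 9 * (1 + 64 / \<tau>\<^sup>2) * real m * real q"
    by (intro mult_left_mono) auto
  finally have EV: "expectation V \<le> 2 * 2 ^ l0 + 9 * (1 + 64 / \<tau>\<^sup>2) * real m * real q"
    using dyadic by simp
  have "expectation R = 2 * \<tau> * 2 ^ l0 + (\<Sum>i\<le>l0. 4 * 2 ^ i + (2 ^ i + 2 * real m))"
    unfolding R_def using S U by (simp add: Bochner_Integration.integrable_sum prob_space)
  also have "\<dots> = 2 * \<tau> * 2 ^ l0 + 5 * (\<Sum>i\<le>l0. 2 ^ i) + 2 * real m * (real l0 + 1)"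
    by (simp add: sum.distrib sum_distrib_left[symmetric] algebra_simps)
  finally have ER: "expectation R \<le> 2 * \<tau> * 2 ^ l0 + 10 * 2 ^ l0 + 2 * real m * (real l0 + 1)"
    using dyadic by simp
  have "risk M Z \<psi> smin smax \<tau> n m f \<le> (\<integral>\<^sup>+\<omega>. ennreal (H \<omega>) \<partial>M)"
    unfolding risk_def by (intro nn_integral_mono ennreal_leI loss)
  also have "\<dots> = ennreal (expectation H)"
    using order_trans[OF zero_le_power2 loss] int_H by (intro nn_integral_eq_integral) auto
  also have "expectation H = 2 * (expectation V / real n + (b + expectation R / real n))"
    unfolding H_def using int_V int_R by (simp add: prob_space)
  also have "\<dots> = 2 * (b + (expectation V + expectation R) / real n)"
    by (simp add: add_divide_distrib)
  also have "\<dots> \<le> 2 * (b + ((2 * 2 ^ l0 + 9 * (1 + 64 / \<tau>\<^sup>2) * real m * real q)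
      + (2 * \<tau> * 2 ^ l0 + 10 * 2 ^ l0 + 2 * real m * (real l0 + 1))) / real n)"
    by (intro mult_left_mono add_left_mono divide_right_mono add_mono EV ER) auto
  also have "(2 * 2 ^ l0 + 9 * (1 + 64 / \<tau>\<^sup>2) * real m * real q)
      + (2 * \<tau> * 2 ^ l0 + 10 * 2 ^ l0 + 2 * real m * (real l0 + 1))
    = (12 + 2 * \<tau>) * 2 ^ l0 + 9 * (1 + 64 / \<tau>\<^sup>2) * real m * real q + 2 * real m * (real l0 + 1)"
    by (simp add: algebra_simps)
  finally show ?thesis by (simp add: ennreal_leI)
qed

section \<open>Besov decay and the choice of the oracle level\<close>

lemma besov_level_energy:
  assumes "f \<in> besov_ball \<psi> s L" "0 < L"
  shows "level_energy (coeff \<psi> f) i \<le> L * (2 powr (- 2 * s)) ^ i"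
proof -
  have "ennreal (2 powr (2 * real i * s) * level_energy (coeff \<psi> f) i) \<le> ennreal L"
    using assms(1) unfolding besov_ball_def level_energy_def by (auto simp: SUP_le_iff)
  then have "2 powr (2 * real i * s) * level_energy (coeff \<psi> f) i \<le> L"
    using assms(2) by (simp add: ennreal_le_iff)
  moreover have "(2 powr (- 2 * s)) ^ i = 2 powr (- (2 * real i * s))"
    by (simp add: powr_realpow[symmetric] powr_powr mult_ac)
  then have "(2 powr (- 2 * s)) ^ i = 1 / 2 powr (2 * real i * s)"
    by (simp only: powr_minus_divide)
  ultimately show ?thesis
    by (simp only:) (simp add: pos_le_divide_eq mult.commute)
qed

lemma besov_energy_sum:
  assumes f: "f \<in> besov_ball \<psi> s L" and L: "0 < L" and s: "0 < s"
    and I: "finite I" "I \<subseteq> {l..}"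
  shows "(\<Sum>i\<in>I. level_energy (coeff \<psi> f) i)
    \<le> L / (1 - 2 powr (- 2 * s)) * (2 powr (- 2 * s)) ^ l"
proof -
  have r: "0 \<le> 2 powr (- 2 * s)" "2 powr (- 2 * s) < (1::real)"
    using s powr_less_mono[of "- 2 * s" 0 2] by auto
  have "(\<Sum>i\<in>I. level_energy (coeff \<psi> f) i) \<le> (\<Sum>i\<in>I. L * (2 powr (- 2 * s)) ^ i)"
    by (intro sum_mono besov_level_energy[OF f L])
  also have "\<dots> \<le> L * ((2 powr (- 2 * s)) ^ l / (1 - 2 powr (- 2 * s)))"
    unfolding sum_distrib_left[symmetric] using L
    by (intro mult_left_mono sum_geometric_le[OF r I]) auto
  finally show ?thesis by (simp add: mult.commute)
qed

theorem theorem4p1: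
  fixes \<psi> :: "nat \<Rightarrow> nat \<Rightarrow> real \<Rightarrow> real" and smin smax L \<tau> :: real
  assumes "orthonormal_basis_L2 \<psi>"
    and "0 < smin" and "smin < smax" and "0 < L" and "2 < \<tau>"
  shows "\<forall>s \<in> {smin<..<smax}. \<exists>C>0.
    \<forall>(n::nat) (m::nat) (M::'w measure) Z.
      1 \<le> n \<and> 1 \<le> m \<and> real m \<le> real n powr (1 / (1 + 2 * smax)) \<and> white_noise M m Z \<longrightarrow>
        (SUP f \<in> besov_ball \<psi> s L. risk M Z \<psi> smin smax \<tau> n m f)
          \<le> ennreal (C * real n powr (- 2 * s / (1 + 2 * s)))"
proof
  fix s assume "s \<in> {smin<..<smax}"
  then have s: "smin < s" "s < smax" "0 < s" using assms by auto
  have tau: "0 < \<tau>" using assms by simp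
  define r where "r = 2 powr (- 2 * s)"
  have r: "0 < r" "r < 1" using s powr_less_mono[of "- 2 * s" 0 2] by (auto simp: r_def)
  define c0 where "c0 = L / (1 - r)"
  have c0: "0 < c0" using r assms by (simp add: c0_def)
  \<comment> \<open>Raising the oracle level by \<open>\<kappa>\<close> pushes the signal above it
    below a quarter of the test threshold, as the overshoot bound requires.\<close>
  obtain \<kappa> where \<kappa>: "4 * (1 + 8 / \<tau>) * c0 / \<tau> < 2 ^ \<kappa>"
    using real_arch_pow[of 2] by auto
  \<comment> \<open>The power of \<open>n\<close> by which the bound on \<open>m\<close> falls short
    of \<open>n powr (1 / (1 + 2 * s))\<close>; it absorbs the logarithm.\<close>
  define \<epsilon> where "\<epsilon> = 1 / (1 + 2 * s) - 1 / (1 + 2 * smax)"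
  have \<epsilon>: "0 < \<epsilon>" unfolding \<epsilon>_def using s by (simp add: frac_less2)
  \<comment> \<open>The top of the grid exceeds the ideal level by
    \<open>\<delta> * log 2 n\<close>. For \<open>n > n0\<close> this leaves room for the shift by
    \<open>\<kappa>\<close> and the rounding.\<close>
  define \<delta> where "\<delta> = 1 / (1 + 2 * smin) - 1 / (1 + 2 * s)"
  have \<delta>: "0 < \<delta>" unfolding \<delta>_def using s assms by (simp add: frac_less2)
  define n0 where "n0 = 2 powr ((real \<kappa> + 1) / \<delta>)"
  \<comment> \<open>\<open>K1\<close> compares \<open>2 ^ l0\<close>, and \<open>K2\<close> compares
    \<open>m\<close> times the number of levels, with
    \<open>n powr (1 / (1 + 2 * s))\<close>.\<close>
  define K1 :: real where "K1 = 2 ^ (\<kappa> + 1)"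
  define K2 where "K2 = 1 / (\<epsilon> * ln 2) + real \<kappa> + 2"
  have K: "0 < K1" "0 < K2" "0 < n0"
    using \<epsilon> by (auto simp: K1_def K2_def n0_def intro!: add_nonneg_pos)
  define C where "C = 2 * ((\<tau> / 4 * K1 + c0 * n0) + ((12 + 2 * \<tau>) * K1 + 9 * (1 + 64 / \<tau>\<^sup>2) * K2 + 2 * K2))"
  have "0 < C"
    unfolding C_def using K tau c0 by (intro mult_pos_pos add_pos_pos) (auto intro!: add_pos_nonneg)
  moreover have "(SUP f \<in> besov_ball \<psi> s L. risk M Z \<psi> smin smax \<tau> n m f)
          \<le> ennreal (C * real n powr (- 2 * s / (1 + 2 * s)))"
    if n: "1 \<le> n" and m: "1 \<le> m" and mn: "real m \<le> real n powr (1 / (1 + 2 * smax))"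
      and wn: "white_noise M m Z"
    for n m :: nat and M :: "'w measure" and Z
  proof (rule SUP_least)
    fix f assume f: "f \<in> besov_ball \<psi> s L"
    define lg where "lg = log 2 (real n)"
    have lg: "0 \<le> lg" and n_lg: "real n = 2 powr lg" using n by (auto simp: lg_def)
    define x where "x = real n powr (1 / (1 + 2 * s))"
    have x: "1 \<le> x" using n s by (simp add: x_def ge_one_powr_ge_zero)
    have rate: "real n powr (- 2 * s / (1 + 2 * s)) = x / real n"
    proof -
      have "- 2 * s / (1 + 2 * s) = 1 / (1 + 2 * s) - 1" using s by (simp add: field_simps)
      then show ?thesis using n by (simp add: x_def powr_diff)
    qed
    define l0 where "l0 = nat \<lceil>lg / (1 + 2 * s)\<rceil> + \<kappa>"
    have l0_ge: "lg / (1 + 2 * s) + real \<kappa> \<le> real l0"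
      by (simp add: l0_def real_nat_ceiling_ge)
    have l0_le: "real l0 \<le> lg / (1 + 2 * s) + real \<kappa> + 1"
      using lg s of_int_ceiling_le_add_one[of "lg / (1 + 2 * s)"] by (simp add: l0_def)
    have l0_large: "log 2 (real n) / (1 + 2 * smax) \<le> real l0"
    proof -
      have "lg / (1 + 2 * smax) \<le> lg / (1 + 2 * s)"
        using lg s by (intro divide_left_mono) auto
      then show ?thesis using l0_ge by (simp add: lg_def)
    qed
    have x_lg: "x = 2 powr (lg / (1 + 2 * s))"
      by (simp add: x_def n_lg powr_powr)
    have pow_l0: "2 ^ l0 \<le> K1 * x"
    proof -
      have "(2::real) ^ l0 = 2 powr real l0" by (simp add: powr_realpow)
      also have "\<dots> \<le> 2 powr (lg / (1 + 2 * s) + real (\<kappa> + 1))"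
        using l0_le by (intro powr_mono) auto
      also have "\<dots> = K1 * x"
        unfolding powr_add x_lg K1_def by (subst powr_realpow) auto
      finally show ?thesis .
    qed
    have tail_small: "(1 + 8 / \<tau>) * (c0 * r ^ l) \<le> \<tau> / 4 * 2 ^ l / real n" if l: "l0 \<le> l" for l
    proof -
      \<comment> \<open>Since \<open>r ^ l = 2 powr (- 2 * s * l)\<close>, the claim asks that
        \<open>2 powr (l * (1 + 2 * s))\<close> dominate \<open>n * 2 ^ \<kappa>\<close>, which the
        choice of \<open>l0\<close> ensures.\<close>
      have "lg + real \<kappa> \<le> lg + real \<kappa> * (1 + 2 * s)" using s by (simp add: algebra_simps)
      also have "\<dots> = (lg / (1 + 2 * s) + real \<kappa>) * (1 + 2 * s)" using s by (simp add: distrib_right)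
      also have "\<dots> \<le> real l * (1 + 2 * s)"
        using l0_ge l s by (intro mult_right_mono) auto
      finally have "2 powr (lg + real \<kappa>) \<le> 2 powr (real l * (1 + 2 * s))"
        by (rule powr_mono) simp
      moreover have "2 powr (lg + real \<kappa>) = real n * 2 ^ \<kappa>"
        by (simp add: powr_add n_lg powr_realpow)
      moreover have "2 powr (real l * (1 + 2 * s)) * r ^ l = 2 ^ l"
        by (simp add: r_def powr_realpow[symmetric] powr_powr powr_add[symmetric] algebra_simps)
      moreover have "0 < r ^ l" using r by simp
      ultimately have "real n * 2 ^ \<kappa> * r ^ l \<le> 2 ^ l"
        by (metis mult_right_mono less_imp_le)
      moreover have "real n * (4 * (1 + 8 / \<tau>) * c0 / \<tau>) * r ^ l \<le> real n * 2 ^ \<kappa> * r ^ l"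
        using \<kappa> r by (intro mult_right_mono mult_left_mono) auto
      ultimately have "real n * (4 * (1 + 8 / \<tau>) * c0 / \<tau>) * r ^ l \<le> 2 ^ l" by linarith
      then have "\<tau> / (4 * real n) * (real n * (4 * (1 + 8 / \<tau>) * c0 / \<tau>) * r ^ l) \<le> \<tau> / (4 * real n) * 2 ^ l"
        using tau by (intro mult_left_mono) auto
      moreover have cancel: "\<tau> / (4 * real n) * (real n * (4 * a * c0 / \<tau>) * r ^ l) = a * (c0 * r ^ l)" for a
        using n tau by simp
      ultimately have "(1 + 8 / \<tau>) * (c0 * r ^ l) \<le> \<tau> / (4 * real n) * 2 ^ l"
        by (simp only: cancel)
      then show ?thesis by simp
    qed
    have energy: "(\<Sum>i\<in>I. level_energy (coeff \<psi> f) i) \<le> c0 * r ^ l" if "finite I" "I \<subseteq> {l..}" for I l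
      using besov_energy_sum[OF f assms(4) s(3) that] by (simp add: c0_def r_def)
    define q where "q = nat \<lfloor>log 2 (real n) / (1 + 2 * smin)\<rfloor>"
    \<comment> \<open>If the oracle level is above the grid, \<open>b\<close> is a bound on the
      total energy; otherwise the tail beyond \<open>l0\<close> is already of variance
      order.\<close>
    define b where "b = (if q < l0 then c0 else \<tau> / 4 * 2 ^ l0 / real n)"
    have risk: "risk M Z \<psi> smin smax \<tau> n m f \<le> ennreal (2 * (b + ((12 + 2 * \<tau>) * 2 ^ l0
      + 9 * (1 + 64 / \<tau>\<^sup>2) * real m * real q + 2 * real m * (real l0 + 1)) / real n))"
    proof (rule risk_bound[OF assms(1) _ wn n m tau assms(2) l0_large q_def])
      show "f \<in> L2_space" using f by (simp add: besov_ball_def)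
      show "(1 + 8 / \<tau>) * (\<Sum>i=l..l'. level_energy (coeff \<psi> f) i) \<le> \<tau> / 4 * 2 ^ l' / real n"
        if "l0 \<le> l" "l \<le> l'" for l l'
      proof -
        have "(1 + 8 / \<tau>) * (\<Sum>i=l..l'. level_energy (coeff \<psi> f) i) \<le> (1 + 8 / \<tau>) * (c0 * r ^ l)"
          using tau by (intro mult_left_mono energy) auto
        also have "\<dots> \<le> \<tau> / 4 * 2 ^ l / real n" using that by (intro tail_small)
        also have "\<dots> \<le> \<tau> / 4 * 2 ^ l' / real n"
          using tau that by (intro divide_right_mono mult_left_mono power_increasing) auto
        finally show ?thesis .
      qed
      have total: "(\<Sum>i\<in>I. level_energy (coeff \<psi> f) i) \<le> c0" if "finite I" for I
        using energy[OF that, of 0] by simp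
      show "(\<Sum>i<N. level_energy (coeff \<psi> f) i) \<le> b" if "q < l0" for N
        using total that by (simp add: b_def)
      show "(\<Sum>i\<in>{l0<..<N}. level_energy (coeff \<psi> f) i) \<le> b" for N
      proof (cases "q < l0")
        case True
        then show ?thesis using total by (simp add: b_def)
      next
        case False
        have "(\<Sum>i\<in>{l0<..<N}. level_energy (coeff \<psi> f) i) \<le> c0 * r ^ l0"
          by (rule energy) auto
        also have "\<dots> \<le> (1 + 8 / \<tau>) * (c0 * r ^ l0)"
          using tau c0 r by (simp add: distrib_right)
        also have "\<dots> \<le> \<tau> / 4 * 2 ^ l0 / real n" by (rule tail_small) simp
        finally show ?thesis using False by (simp add: b_def)
      qed
    qed
    have b_le: "b \<le> (\<tau> / 4 * K1 + c0 * n0) * (x / real n)"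
    proof (cases "q < l0")
      case True
      \<comment> \<open>The oracle level can lie above the grid only when \<open>n \<le> n0\<close>;
        then \<open>x / n\<close> is at least \<open>1 / n0\<close>, and the constant
        \<open>c0\<close> is within the rate.\<close>
      have "lg / (1 + 2 * smin) < real q + 1"
        unfolding q_def lg_def[symmetric] using lg assms by linarith
      then have "lg / (1 + 2 * smin) < lg / (1 + 2 * s) + real \<kappa> + 1"
        using True l0_le by linarith
      then have "lg * \<delta> < real \<kappa> + 1" by (simp add: \<delta>_def right_diff_distrib)
      then have "lg \<le> (real \<kappa> + 1) / \<delta>" using \<delta> by (simp add: pos_le_divide_eq)
      then have "real n \<le> n0" unfolding n_lg n0_def by (rule powr_mono) simp
      then have "real n * 1 \<le> n0 * x" using x by (intro mult_mono) auto
      then have "1 \<le> n0 * (x / real n)" using n by (simp add: field_simps)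
      then have "c0 * 1 \<le> c0 * (n0 * (x / real n))" using c0 by (intro mult_left_mono) auto
      moreover have "0 \<le> \<tau> / 4 * K1 * (x / real n)" using tau K x by simp
      ultimately show ?thesis using True unfolding b_def distrib_right by simp
    next
      case False
      have "\<tau> / 4 * 2 ^ l0 / real n \<le> \<tau> / 4 * (K1 * x) / real n"
        using tau pow_l0 by (intro divide_right_mono mult_left_mono) auto
      moreover have "0 \<le> c0 * n0 * (x / real n)" using c0 K x by simp
      ultimately show ?thesis using False unfolding b_def distrib_right by simp
    qed
    have log_le: "real m * (lg + real \<kappa> + 2) \<le> K2 * x"
    proof -
      have one: "1 \<le> real n powr \<epsilon>" using n \<epsilon> by (simp add: ge_one_powr_ge_zero)
      \<comment> \<open>A logarithm is at most a multiple of \<open>n powr \<epsilon>\<close>, and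
        \<open>\<epsilon>\<close> is exactly the exponent missing between \<open>m\<close> and
        \<open>x\<close>.\<close>
      have "lg \<le> (real n powr \<epsilon> / \<epsilon>) / ln 2"
        unfolding lg_def log_def using n \<epsilon> by (intro divide_right_mono ln_powr_bound) auto
      moreover have "(real \<kappa> + 2) * 1 \<le> (real \<kappa> + 2) * real n powr \<epsilon>"
        using one by (intro mult_left_mono) auto
      ultimately have "lg + real \<kappa> + 2 \<le> K2 * real n powr \<epsilon>"
        by (simp add: K2_def distrib_right)
      then have "real m * (lg + real \<kappa> + 2)
          \<le> real n powr (1 / (1 + 2 * smax)) * (K2 * real n powr \<epsilon>)"
        using mn lg by (intro mult_mono) auto
      also have "\<dots> = K2 * x"
        using n by (simp add: x_def \<epsilon>_def powr_add[symmetric])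
      finally show ?thesis .
    qed
    have mq: "real m * real q \<le> K2 * x"
    proof -
      have "real q \<le> lg / (1 + 2 * smin)"
        unfolding q_def lg_def[symmetric] using lg assms by (intro of_nat_floor) auto
      also have "\<dots> \<le> lg / 1" using lg assms by (intro divide_left_mono) auto
      finally have "real m * real q \<le> real m * (lg + real \<kappa> + 2)"
        by (intro mult_left_mono) auto
      then show ?thesis using log_le by linarith
    qed
    have ml: "real m * (real l0 + 1) \<le> K2 * x"
    proof -
      have "lg / (1 + 2 * s) \<le> lg / 1" using lg s by (intro divide_left_mono) auto
      then have "real m * (real l0 + 1) \<le> real m * (lg + real \<kappa> + 2)"
        using l0_le by (intro mult_left_mono) auto
      then show ?thesis using log_le by linarith
    qed
    have "(12 + 2 * \<tau>) * 2 ^ l0 + 9 * (1 + 64 / \<tau>\<^sup>2) * real m * real q + 2 * real m * (real l0 + 1)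
        \<le> (12 + 2 * \<tau>) * (K1 * x) + 9 * (1 + 64 / \<tau>\<^sup>2) * (K2 * x) + 2 * (K2 * x)"
      unfolding mult.assoc[of _ "real m"]
      using tau by (intro add_mono mult_left_mono pow_l0 mq ml) auto
    also have "\<dots> = ((12 + 2 * \<tau>) * K1 + 9 * (1 + 64 / \<tau>\<^sup>2) * K2 + 2 * K2) * x"
      by (simp only: distrib_right mult.assoc)
    finally have "((12 + 2 * \<tau>) * 2 ^ l0 + 9 * (1 + 64 / \<tau>\<^sup>2) * real m * real q
          + 2 * real m * (real l0 + 1)) / real n
        \<le> ((12 + 2 * \<tau>) * K1 + 9 * (1 + 64 / \<tau>\<^sup>2) * K2 + 2 * K2) * (x / real n)"
      unfolding times_divide_eq_right by (rule divide_right_mono) simp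
    then have "2 * (b + ((12 + 2 * \<tau>) * 2 ^ l0 + 9 * (1 + 64 / \<tau>\<^sup>2) * real m * real q
          + 2 * real m * (real l0 + 1)) / real n) \<le> C * (x / real n)"
      unfolding C_def mult.assoc[of 2 _ "x / real n"] distrib_right[of _ _ "x / real n"]
      using b_le unfolding distrib_right[of _ _ "x / real n"] by (intro mult_left_mono add_mono) auto
    then show "risk M Z \<psi> smin smax \<tau> n m f \<le> ennreal (C * real n powr (- 2 * s / (1 + 2 * s)))"
      unfolding rate by (intro order_trans[OF risk] ennreal_leI)
  qed
  ultimately show "\<exists>C>0. \<forall>(n::nat) (m::nat) (M::'w measure) Z.
      1 \<le> n \<and> 1 \<le> m \<and> real m \<le> real n powr (1 / (1 + 2 * smax)) \<and> white_noise M m Z \<longrightarrow>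
        (SUP f \<in> besov_ball \<psi> s L. risk M Z \<psi> smin smax \<tau> n m f)
          \<le> ennreal (C * real n powr (- 2 * s / (1 + 2 * s)))"
    by blast
qed

end
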